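(* Suppose $\psi$ is $\mu$-strongly convex with $\mu>0$ and the iterates $\boldsymbol{x}_1,\dots,\boldsymbol{x}_{T+1}$ are produced by the General Proximal Gradient Method under the Random Reshuffle ($\mathsf{RR}$) sampling scheme, for arbitrary $T\in\mathbb{N}$, with stepsizes $\eta_t=\frac{m}{\mu t}$ for all $t\in[T]$, where $m\in\mathbb{N}$. Then for any $\boldsymbol{z}\in\mathbb{R}^d$, $$\mathbb{E}[F(\boldsymbol{x}_{T+1})-F(\boldsymbol{z})]\le O\left(\frac{\mu\|\boldsymbol{z}-\boldsymbol{x}_1\|^2}{\binom{m+T}{m}}+\frac{m\sqrt{n}\,G_{f,1}G_{f,2}(1+\log T)}{\mu T}\right).$$
   Context: Notation: $\mathbb{N}=\{1,2,\dots\}$, $[m]=\{1,\dots,m\}$, $\|\cdot\|$ and $\langle\cdot,\cdot\rangle$ are the Euclidean norm and inner product on $\mathbb{R}^d$, $\overline{\mathbb{R}}=(-\infty,+\infty]$, $\mathrm{dom}\,h=\{\boldsymbol{x}:h(\boldsymbol{x})<+\infty\}$, $\partial h(\boldsymbol{x})$ is the convex subdifferential and $\nabla h(\boldsymbol{x})$ denotes an element of $\partial h(\boldsymbol{x})$. $O(\cdot)$ hides an absolute constant. Problem: $F=f+\psi$ with $f=\frac1n\sum_{i=1}^n f_i$, each $f_i:\mathbb{R}^d\to\mathbb{R}$ convex, and $\psi:\mathbb{R}^d\to\overline{\mathbb{R}}$ proper, closed and convex. $\mu$-strong convexity of $\psi$ means $\psi(\boldsymbol{x})-\psi(\boldsymbol{y})-\langle\nabla\psi(\boldsymbol{y}),\boldsymbol{x}-\boldsymbol{y}\rangle\ge\frac\mu2\|\boldsymbol{x}-\boldsymbol{y}\|^2$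 for all $\boldsymbol{x}\in\mathbb{R}^d$, $\boldsymbol{y}\in\mathrm{dom}\,\psi$ with $\partial\psi(\boldsymbol{y})\neq\varnothing$, and $\nabla\psi(\boldsymbol{y})\in\partial\psi(\boldsymbol{y})$. Each $f_i$ is $G_i$-Lipschitz on $\mathrm{dom}\,\psi$ for some $G_i>0$. For every $i\in[n]$ and $\boldsymbol{x}\in\mathbb{R}^d$, $\nabla f_i(\boldsymbol{x})$ is deterministically picked from $\partial f_i(\boldsymbol{x})$. Put $G_{f,1}=\frac1n\sum_{i=1}^nG_i$ and $G_{f,2}=\sqrt{\frac1n\sum_{i=1}^nG_i^2}$. General Proximal Gradient Method: given an initial point $\boldsymbol{x}_1\in\mathrm{dom}\,\psi$ and stepsizes $\eta_t>0$, $t\in[T]$, for $t=1,\dots,T$ generate an index $\mathsf{i}(t)\in[n]$ and set $$\boldsymbol{x}_{t+1}=\mathrm{argmin}_{\boldsymbol{x}\in\mathbb{R}^d}\ \psi(\boldsymbol{x})+\langle\nabla f_{\mathsf{i}(t)}(\boldsymbol{x}_t),\boldsymbol{x}\rangle+\frac{\|\boldsymbol{x}-\boldsymbol{x}_t\|^2}{2\eta_t}.$$ For $t\in\mathbb{N}$, $\mathsf{q}(t)=\lceil t/n\rceil$ and $\mathsf{r}(t)=t-(\mathsf{q}(t)-1)n\in[n]$. $\mathsf{RR}$ sampling scheme: $\mathsf{i}(t)=\pi_{\mathsf{q}(t)}^{\mathsf{r}(t)}$ where $\pi_1,\dots,\pi_{\mathsf{q}(T)}$ are mutually independent uniformly random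 permutations of $[n]$, and $\pi^j$ denotes the $j$-th entry of $\pi$.
   Formalization: "G_i-Lipschitz on dom ψ" is taken to include that the selected subgradient satisfies ‖∇f_i(x)‖ ≤ G_i for all x in dom ψ; without this bound at boundary points of dom ψ the claim is false. *)

theory Defs
  imports "HOL-Probability.Probability" "Jordan_Normal_Form.Matrix"
begin

(* R^d is carrier_vec d :: real vec set with inner product scalar_prod.  Keeping d a term (not
   a type) lets an absolute constant be quantified before the dimension. *)

definition vnorm :: "real vec \<Rightarrow> real" where
  "vnorm x = sqrt (scalar_prod x x)"

definition edom :: "nat \<Rightarrow> (real vec \<Rightarrow> ereal) \<Rightarrow> real vec set" where
  "edom d h = {x \<in> carrier_vec d. h x < \<infinity>}"

definition proper_fun :: "nat \<Rightarrow> (real vec \<Rightarrow> ereal) \<Rightarrow> bool" where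
  "proper_fun d h \<longleftrightarrow> (\<forall>x\<in>carrier_vec d. h x \<noteq> -\<infinity>) \<and> edom d h \<noteq> {}"

definition convex_fun :: "nat \<Rightarrow> (real vec \<Rightarrow> ereal) \<Rightarrow> bool" where
  "convex_fun d h \<longleftrightarrow>
     (\<forall>x\<in>carrier_vec d. \<forall>y\<in>carrier_vec d. \<forall>u::real. 0 < u \<and> u < 1 \<longrightarrow>
        h ((1 - u) \<cdot>\<^sub>v x + u \<cdot>\<^sub>v y) \<le> ereal (1 - u) * h x + ereal u * h y)"

(* Closedness of the epigraph in R^d x R, by sequences. *)
definition closed_fun :: "nat \<Rightarrow> (real vec \<Rightarrow> ereal) \<Rightarrow> bool" where
  "closed_fun d h \<longleftrightarrow>
     (\<forall>X R. \<forall>x\<in>carrier_vec d. \<forall>r::real.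
        (\<forall>k::nat. X k \<in> carrier_vec d \<and> h (X k) \<le> ereal (R k)) \<and>
        (\<lambda>k. vnorm (X k - x)) \<longlonglongrightarrow> 0 \<and> R \<longlonglongrightarrow> r \<longrightarrow> h x \<le> ereal r)"

(* For proper h this is empty outside edom d h. *)
definition subdiff :: "nat \<Rightarrow> (real vec \<Rightarrow> ereal) \<Rightarrow> real vec \<Rightarrow> real vec set" where
  "subdiff d h x =
     {v \<in> carrier_vec d. \<forall>y\<in>carrier_vec d. h x + ereal (scalar_prod v (y - x)) \<le> h y}"

definition strongly_convex_fun :: "nat \<Rightarrow> real \<Rightarrow> (real vec \<Rightarrow> ereal) \<Rightarrow> bool" where
  "strongly_convex_fun d \<mu> h \<longleftrightarrow>
     (\<forall>x\<in>carrier_vec d. \<forall>y\<in>edom d h. \<forall>v\<in>subdiff d h y.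
        h x - h y - ereal (scalar_prod v (x - y)) \<ge> ereal (\<mu> / 2 * (vnorm (x - y))\<^sup>2))"

definition composite ::
  "nat \<Rightarrow> (nat \<Rightarrow> real vec \<Rightarrow> real) \<Rightarrow> (real vec \<Rightarrow> ereal) \<Rightarrow> real vec \<Rightarrow> ereal" where
  "composite n f \<psi> x = ereal ((\<Sum>i=1..n. f i x) / real n) + \<psi> x"

definition prox_gradient_iterates ::
  "nat \<Rightarrow> (real vec \<Rightarrow> ereal) \<Rightarrow> (nat \<Rightarrow> real vec \<Rightarrow> real vec) \<Rightarrow> (nat \<Rightarrow> real) \<Rightarrow> nat
     \<Rightarrow> real vec \<Rightarrow> (nat \<Rightarrow> nat) \<Rightarrow> (nat \<Rightarrow> real vec) \<Rightarrow> bool" where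
  "prox_gradient_iterates d \<psi> g \<eta> T x1 idx x \<longleftrightarrow>
     x 1 = x1 \<and>
     (\<forall>t\<in>{1..T}.
        is_arg_min
          (\<lambda>y. \<psi> y + ereal (scalar_prod (g (idx t) (x t)) y)
                 + ereal ((vnorm (y - x t))\<^sup>2 / (2 * \<eta> t)))
          (\<lambda>y. y \<in> carrier_vec d) (x (Suc t)))"

definition epoch :: "nat \<Rightarrow> nat \<Rightarrow> nat" where
  "epoch n t = nat \<lceil>real t / real n\<rceil>"

definition epoch_pos :: "nat \<Rightarrow> nat \<Rightarrow> nat" where
  "epoch_pos n t = t - (epoch n t - 1) * n"

(* Law of K independent uniformly random permutations of {1..n}: under it, \<omega> k is the k-th
   permutation and \<omega> k j its j-th entry. *)
definition rr_pmf :: "nat \<Rightarrow> nat \<Rightarrow> (nat \<Rightarrow> nat \<Rightarrow> nat) pmf" where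
  "rr_pmf n K = Pi_pmf {1..K} id (\<lambda>_. pmf_of_set {\<pi>. \<pi> permutes {1..n}})"

definition rr_index :: "nat \<Rightarrow> (nat \<Rightarrow> nat \<Rightarrow> nat) \<Rightarrow> nat \<Rightarrow> nat" where
  "rr_index n \<omega> t = \<omega> (epoch n t) (epoch_pos n t)"

(* E[X] = E[X^+] - E[X^-]; needed since \<psi> z may be infinite.  e2ennreal sends negative
   arguments to 0. *)
definition ereal_expectation :: "'w measure \<Rightarrow> ('w \<Rightarrow> ereal) \<Rightarrow> ereal" where
  "ereal_expectation M X =
     enn2ereal (\<integral>\<^sup>+\<omega>. e2ennreal (X \<omega>) \<partial>M) - enn2ereal (\<integral>\<^sup>+\<omega>. e2ennreal (- X \<omega>) \<partial>M)"

definition mean_lip :: "nat \<Rightarrow> (nat \<Rightarrow> real) \<Rightarrow> real" where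
  "mean_lip n G = (\<Sum>i=1..n. G i) / real n"

definition rms_lip :: "nat \<Rightarrow> (nat \<Rightarrow> real) \<Rightarrow> real" where
  "rms_lip n G = sqrt ((\<Sum>i=1..n. (G i)\<^sup>2) / real n)"

(* The Lipschitz bound on edom d \<psi> also covers the selected subgradients: on the boundary of
   edom d \<psi> a subgradient of h on R^d can be arbitrarily large although h restricted to
   edom d \<psi> is Lipschitz. *)
definition lipschitz_with_subgrad ::
  "real vec set \<Rightarrow> real \<Rightarrow> (real vec \<Rightarrow> real) \<Rightarrow> (real vec \<Rightarrow> real vec) \<Rightarrow> bool" where
  "lipschitz_with_subgrad S L h v \<longleftrightarrow>
     (\<forall>x\<in>S. \<forall>y\<in>S. \<bar>h x - h y\<bar> \<le> L * vnorm (x - y)) \<and> (\<forall>x\<in>S. vnorm (v x) \<le> L)"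

end

theory Submission
  imports Defs
begin

text \<open>
Two difficulties meet here: the bound is for the last iterate and not for an average, and within an
epoch the sampled index is not independent of the iterate, so that the sampled component is a
biased substitute for the average \<open>f\<close>.

The bias is controlled by exchangeability. Transposing two entries of a uniformly random
permutation preserves its law (\<open>map_pmf_swap_entries\<close>), hence the expectations of \<open>f (x k)\<close> and of
\<open>f\<^sub>i (x k)\<close>, with \<open>i\<close> the index sampled at a time \<open>t \<ge> k\<close>, differ only through the reaction of \<open>x k\<close> to
one transposition (\<open>rr_exchange\<close>). A proximal step is a contraction, and subgradients are
monotone; so after the first changed index the squared distance of the two runs grows at each step
by at most the squared step size times the squared jump of a subgradient. In one epoch every component occurs at most once, and
the squares sum up to \<open>n (rms_lip n G)\<^sup>2\<close>. With \<open>\<eta> t = m / (\<mu> t)\<close> the contraction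
\<open>t / (t + m)\<close> exactly compensates larger earlier step sizes, which gives a distance
of at most \<open>2 \<eta> k \<surd>n rms_lip n G\<close> (\<open>run_stability\<close>) and a bias of at most
\<open>2 \<eta> k \<surd>n mean_lip n G rms_lip n G\<close> (\<open>sampling_bias\<close>).

For the last iterate, step \<open>t\<close> is compared not with \<open>z\<close> but with a convex combination of \<open>z\<close> and
the earlier iterates, pulled towards each new iterate. The weights are chosen so that the distances
and the function values telescope simultaneously and the last combination is the last iterate
itself (\<open>ref_value_bound\<close>). The weight of step \<open>t\<close> is the binomial coefficient of
\<open>t + m - 1\<close> over \<open>t\<close>; the sum of all weights divides the initial distance, and
each error of order \<open>\<eta> t\<close> is multiplied by at most \<open>1 / (T - t + 1)\<close>, so the errors sum
up to order \<open>m (1 + ln T) / (\<mu> T)\<close> (\<open>mix_step_sum\<close>). The absolute constant is 12.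
\<close>

section \<open>Euclidean geometry of coordinate vectors\<close>

lemma vnorm_sq: "(vnorm x)\<^sup>2 = scalar_prod x x"
  by (simp add: vnorm_def scalar_prod_def sum_nonneg)

lemma vnorm_nonneg [simp]: "0 \<le> vnorm x"
  by (simp add: vnorm_def scalar_prod_def sum_nonneg)

lemma vnorm_minus_sq:
  fixes x y :: "real vec"
  assumes "x \<in> carrier_vec d" "y \<in> carrier_vec d"
  shows "(vnorm (x - y))\<^sup>2 = scalar_prod x x - 2 * scalar_prod x y + scalar_prod y y"
  using assms comm_scalar_prod[OF assms]
  by (simp add: vnorm_sq minus_scalar_prod_distrib[of _ d] scalar_prod_minus_distrib[of _ d])

lemma vnorm_minus_commute:
  assumes "x \<in> carrier_vec d" "y \<in> carrier_vec d"
  shows "vnorm (x - y) = vnorm (y - x)"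
proof (rule power2_eq_imp_eq)
  show "(vnorm (x - y))\<^sup>2 = (vnorm (y - x))\<^sup>2"
    using comm_scalar_prod[OF assms] by (simp add: vnorm_minus_sq[OF assms] vnorm_minus_sq[OF assms(2,1)])
qed auto

lemma abs_scalar_prod_le:
  fixes x y :: "real vec"
  assumes "x \<in> carrier_vec d" "y \<in> carrier_vec d"
  shows "\<bar>scalar_prod x y\<bar> \<le> vnorm x * vnorm y"
proof -
  have "(scalar_prod x y)\<^sup>2 \<le> scalar_prod x x * scalar_prod y y"
    using Cauchy_Schwarz_ineq_sum[of "vec_index x" "vec_index y" "{0..<d}"] assms
    by (simp add: scalar_prod_def power2_eq_square)
  then have "(scalar_prod x y)\<^sup>2 \<le> (vnorm x * vnorm y)\<^sup>2"
    by (simp add: power_mult_distrib vnorm_sq)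
  then show ?thesis
    by (simp add: abs_le_square_iff[symmetric] abs_mult)
qed

lemma vnorm_minus_sq_le:
  fixes x y :: "real vec"
  assumes "x \<in> carrier_vec d" "y \<in> carrier_vec d"
  shows "(vnorm (x - y))\<^sup>2 \<le> 2 * (vnorm x)\<^sup>2 + 2 * (vnorm y)\<^sup>2"
proof -
  have "- scalar_prod x y \<le> vnorm x * vnorm y"
    using abs_scalar_prod_le[OF assms] by simp
  moreover have "2 * (vnorm x * vnorm y) \<le> (vnorm x)\<^sup>2 + (vnorm y)\<^sup>2"
    using sum_squares_bound[of "vnorm x" "vnorm y"] by simp
  ultimately show ?thesis
    unfolding vnorm_minus_sq[OF assms] vnorm_sq[of x] vnorm_sq[of y] by linarith
qed

lemma vnorm_convex_combination_sq:
  fixes w p :: "real vec"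
  assumes "w \<in> carrier_vec d" "p \<in> carrier_vec d"
  shows "(vnorm (((1 - u) \<cdot>\<^sub>v w + u \<cdot>\<^sub>v p) - p))\<^sup>2 = (1 - u)\<^sup>2 * (vnorm (w - p))\<^sup>2"
proof -
  have "((1 - u) \<cdot>\<^sub>v w + u \<cdot>\<^sub>v p) - p = (1 - u) \<cdot>\<^sub>v (w - p)"
    using assms by (intro eq_vecI) (auto simp: algebra_simps)
  moreover have "scalar_prod ((1 - u) \<cdot>\<^sub>v (w - p)) ((1 - u) \<cdot>\<^sub>v (w - p))
      = (1 - u)\<^sup>2 * scalar_prod (w - p) (w - p)"
    using assms by (simp add: power2_eq_square)
  ultimately show ?thesis
    by (simp add: vnorm_sq)
qed


lemma vnorm_minus_eq_0:
  assumes "x \<in> carrier_vec d" "y \<in> carrier_vec d" "vnorm (x - y) = 0"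
  shows "x = y"
proof (rule eq_vecI)
  have "(\<Sum>i\<in>{0..<d}. (vec_index x i - vec_index y i)\<^sup>2) = 0"
    using assms vnorm_sq[of "x - y"] by (simp add: scalar_prod_def power2_eq_square)
  then show "vec_index x i = vec_index y i" if "i < dim_vec y" for i
    using that assms(2) by (simp add: sum_nonneg_eq_0_iff)
qed (use assms in auto)


section \<open>One proximal step\<close>

locale strongly_convex_prox =
  fixes d :: nat and \<psi> :: "real vec \<Rightarrow> ereal" and \<mu> :: real
  assumes proper: "proper_fun d \<psi>" and conv: "convex_fun d \<psi>"
    and strong: "strongly_convex_fun d \<mu> \<psi>" and \<mu>_pos: "\<mu> > 0"
begin

definition \<psi>r :: "real vec \<Rightarrow> real" where "\<psi>r y = real_of_ereal (\<psi> y)"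

lemma edom_carrier: "y \<in> edom d \<psi> \<Longrightarrow> y \<in> carrier_vec d"
  by (simp add: edom_def)

lemma \<psi>_eq: "y \<in> edom d \<psi> \<Longrightarrow> \<psi> y = ereal (\<psi>r y)"
  using proper by (auto simp: edom_def proper_fun_def \<psi>r_def ereal_real)

lemma edom_convex:
  assumes x: "x \<in> edom d \<psi>" and y: "y \<in> edom d \<psi>" and u: "0 < u" "u < 1"
  shows "(1 - u) \<cdot>\<^sub>v x + u \<cdot>\<^sub>v y \<in> edom d \<psi>"
    and "\<psi>r ((1 - u) \<cdot>\<^sub>v x + u \<cdot>\<^sub>v y) \<le> (1 - u) * \<psi>r x + u * \<psi>r y"
proof -
  let ?p = "(1 - u) \<cdot>\<^sub>v x + u \<cdot>\<^sub>v y"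
  have le: "\<psi> ?p \<le> ereal ((1 - u) * \<psi>r x + u * \<psi>r y)"
    using conv u edom_carrier[OF x] edom_carrier[OF y] \<psi>_eq[OF x] \<psi>_eq[OF y]
    unfolding convex_fun_def by (metis times_ereal.simps(1) plus_ereal.simps(1))
  have p: "?p \<in> carrier_vec d"
    using edom_carrier[OF x] edom_carrier[OF y] by simp
  with le show dom: "?p \<in> edom d \<psi>"
    by (auto simp: edom_def)
  show "\<psi>r ?p \<le> (1 - u) * \<psi>r x + u * \<psi>r y"
    using le \<psi>_eq[OF dom] by simp
qed

text \<open>The first-order optimality condition of the proximal step: comparing the minimiser \<open>p\<close> with
  \<open>p + u (y - p)\<close> and letting \<open>u \<rightarrow> 0\<close> kills the quadratic remainder.\<close>

lemma prox_optimality: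
  assumes min: "is_arg_min (\<lambda>y. \<psi> y + ereal (scalar_prod v y) + ereal ((vnorm (y - c))\<^sup>2 / (2 * \<eta>)))
                  (\<lambda>y. y \<in> carrier_vec d) p"
    and c: "c \<in> edom d \<psi>" and v: "v \<in> carrier_vec d" and \<eta>: "\<eta> > 0"
  shows "p \<in> edom d \<psi>"
    and "y \<in> edom d \<psi> \<Longrightarrow>
         \<psi>r p + scalar_prod v p + scalar_prod (p - c) p / \<eta>
           \<le> \<psi>r y + scalar_prod v y + scalar_prod (p - c) y / \<eta>"
proof -
  let ?q = "\<lambda>y. scalar_prod v y + (vnorm (y - c))\<^sup>2 / (2 * \<eta>)"
  have pc: "p \<in> carrier_vec d"
    using min by (simp add: is_arg_min_def)
  have cc: "c \<in> carrier_vec d" using edom_carrier[OF c] .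
  have le: "\<psi> p + ereal (?q p) \<le> \<psi> y + ereal (?q y)" if "y \<in> carrier_vec d" for y
    using min that unfolding is_arg_min_def by (auto simp: add.assoc not_less)
  show dom: "p \<in> edom d \<psi>"
    using le[OF cc] \<psi>_eq[OF c] pc by (auto simp: edom_def)
  assume y: "y \<in> edom d \<psi>"
  have yc: "y \<in> carrier_vec d" using edom_carrier[OF y] .
  have leu: "\<psi>r p + scalar_prod v p + scalar_prod (p - c) p / \<eta>
           \<le> \<psi>r y + scalar_prod v y + scalar_prod (p - c) y / \<eta> + u * ((vnorm (y - p))\<^sup>2 / (2 * \<eta>))"
    if u: "0 < u" "u < 1" for u
  proof -
    let ?z = "(1 - u) \<cdot>\<^sub>v p + u \<cdot>\<^sub>v y"
    have zc: "?z \<in> carrier_vec d" using pc yc by simp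
    have "\<psi>r p + ?q p \<le> \<psi>r ?z + ?q ?z"
      using le[OF zc] \<psi>_eq[OF dom] \<psi>_eq[OF edom_convex(1)[OF dom y u]] by simp
    also have "\<psi>r ?z \<le> (1 - u) * \<psi>r p + u * \<psi>r y"
      by (rule edom_convex(2)[OF dom y u])
    finally have 1: "\<psi>r p + ?q p \<le> (1 - u) * \<psi>r p + u * \<psi>r y + ?q ?z" by simp
    have 2: "scalar_prod v ?z = (1 - u) * scalar_prod v p + u * scalar_prod v y"
      using v pc yc by (simp add: scalar_prod_add_distrib[of _ d])
    have "(vnorm (?z - c))\<^sup>2 = (vnorm (p - c))\<^sup>2
            + 2 * u * (scalar_prod (p - c) y - scalar_prod (p - c) p) + u\<^sup>2 * (vnorm (y - p))\<^sup>2"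
      unfolding vnorm_minus_sq[OF zc cc] vnorm_minus_sq[OF pc cc] vnorm_minus_sq[OF yc pc]
      using pc yc cc comm_scalar_prod[OF pc yc] comm_scalar_prod[OF pc cc] comm_scalar_prod[OF cc yc]
      by (simp add: add_scalar_prod_distrib[of _ d]
          scalar_prod_add_distrib[of _ d] minus_scalar_prod_distrib[of _ d] algebra_simps
          power2_eq_square)
    then have 3: "(vnorm (?z - c))\<^sup>2 / (2 * \<eta>) = (vnorm (p - c))\<^sup>2 / (2 * \<eta>)
        + u * ((scalar_prod (p - c) y - scalar_prod (p - c) p) / \<eta> + u * ((vnorm (y - p))\<^sup>2 / (2 * \<eta>)))"
      using \<eta> by (simp only:) (simp add: field_simps power2_eq_square)
    have "u * (\<psi>r p + scalar_prod v p) \<le> u * (\<psi>r y + scalar_prod v y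
       + ((scalar_prod (p - c) y - scalar_prod (p - c) p) / \<eta> + u * ((vnorm (y - p))\<^sup>2 / (2 * \<eta>))))"
      using 1 unfolding 2 3 by (simp only: distrib_left) (simp add: left_diff_distrib)
    then have "\<psi>r p + scalar_prod v p \<le> \<psi>r y + scalar_prod v y
       + ((scalar_prod (p - c) y - scalar_prod (p - c) p) / \<eta> + u * ((vnorm (y - p))\<^sup>2 / (2 * \<eta>)))"
      using u by simp
    then show ?thesis by (simp add: diff_divide_distrib)
  qed
  show "\<psi>r p + scalar_prod v p + scalar_prod (p - c) p / \<eta>
           \<le> \<psi>r y + scalar_prod v y + scalar_prod (p - c) y / \<eta>"
  proof (rule tendsto_lowerbound)
    show "((\<lambda>u. \<psi>r y + scalar_prod v y + scalar_prod (p - c) y / \<eta> + u * ((vnorm (y - p))\<^sup>2 / (2 * \<eta>)))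
       \<longlongrightarrow> \<psi>r y + scalar_prod v y + scalar_prod (p - c) y / \<eta>) (at_right 0)"
      using \<eta> by (auto intro!: tendsto_eq_intros)
    show "\<forall>\<^sub>F u in at_right 0. \<psi>r p + scalar_prod v p + scalar_prod (p - c) p / \<eta>
      \<le> \<psi>r y + scalar_prod v y + scalar_prod (p - c) y / \<eta> + u * ((vnorm (y - p))\<^sup>2 / (2 * \<eta>))"
      using leu by (auto simp: eventually_at_right_field intro!: exI[of _ 1])
  qed simp
qed

text \<open>The optimality condition exhibits a subgradient of \<open>\<psi>\<close> at \<open>p\<close>, to which strong convexity
  applies; the polarisation identity turns the linear term into squared distances.\<close>

lemma prox_three_point:
  assumes min: "is_arg_min (\<lambda>y. \<psi> y + ereal (scalar_prod v y) + ereal ((vnorm (y - c))\<^sup>2 / (2 * \<eta>)))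
                  (\<lambda>y. y \<in> carrier_vec d) p"
    and c: "c \<in> edom d \<psi>" and v: "v \<in> carrier_vec d" and \<eta>: "\<eta> > 0" and y: "y \<in> edom d \<psi>"
  shows "\<psi>r p + scalar_prod v (p - y)
           + ((vnorm (p - c))\<^sup>2 + (vnorm (y - p))\<^sup>2 - (vnorm (y - c))\<^sup>2) / (2 * \<eta>)
           + \<mu> / 2 * (vnorm (y - p))\<^sup>2 \<le> \<psi>r y"
proof -
  note opt = prox_optimality[OF min c v \<eta>]
  have p: "p \<in> carrier_vec d" and cc: "c \<in> carrier_vec d" and yc: "y \<in> carrier_vec d"
    using opt(1) c y edom_carrier by auto
  define s where "s = - v - (1 / \<eta>) \<cdot>\<^sub>v (p - c)"
  have sc: "s \<in> carrier_vec d" using v p cc by (simp add: s_def)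
  have s_prod: "scalar_prod s (w - p) = scalar_prod v p + scalar_prod (p - c) p / \<eta>
      - scalar_prod v w - scalar_prod (p - c) w / \<eta>" if w: "w \<in> carrier_vec d" for w
  proof -
    have "scalar_prod s w' = - scalar_prod v w' - scalar_prod (p - c) w' / \<eta>"
      if "w' \<in> carrier_vec d" for w'
    proof -
      have "scalar_prod s w' = scalar_prod (- v) w' - scalar_prod ((1 / \<eta>) \<cdot>\<^sub>v (p - c)) w'"
        unfolding s_def using v p cc that by (intro minus_scalar_prod_distrib[of _ d]) auto
      then show ?thesis using v p cc that by simp
    qed
    then show ?thesis
      using w p sc by (simp add: scalar_prod_minus_distrib[of _ d])
  qed
  have "s \<in> subdiff d \<psi> p"
    unfolding subdiff_def
  proof (intro CollectI conjI ballI sc)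
    fix w :: "real vec" assume w: "w \<in> carrier_vec d"
    show "\<psi> p + ereal (scalar_prod s (w - p)) \<le> \<psi> w"
    proof (cases "w \<in> edom d \<psi>")
      case True
      then show ?thesis
        using opt(2)[OF True] \<psi>_eq[OF True] \<psi>_eq[OF opt(1)] by (simp add: s_prod[OF w])
    next
      case False
      with w have "\<psi> w = \<infinity>" by (simp add: edom_def)
      then show ?thesis by simp
    qed
  qed
  then have "ereal (\<mu> / 2 * (vnorm (y - p))\<^sup>2) \<le> \<psi> y - \<psi> p - ereal (scalar_prod s (y - p))"
    using strong opt(1) yc unfolding strongly_convex_fun_def by blast
  then have "\<mu> / 2 * (vnorm (y - p))\<^sup>2 \<le> \<psi>r y - \<psi>r p - scalar_prod s (y - p)"
    using \<psi>_eq[OF y] \<psi>_eq[OF opt(1)] by simp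
  moreover have "scalar_prod s (y - p) = scalar_prod v (p - y)
     + ((vnorm (p - c))\<^sup>2 + (vnorm (y - p))\<^sup>2 - (vnorm (y - c))\<^sup>2) / (2 * \<eta>)"
  proof -
    have "2 * scalar_prod (p - c) (p - y)
        = (vnorm (p - c))\<^sup>2 + (vnorm (y - p))\<^sup>2 - (vnorm (y - c))\<^sup>2"
      using p cc yc comm_scalar_prod[OF p yc] comm_scalar_prod[OF p cc] comm_scalar_prod[OF cc yc]
      by (simp add: vnorm_minus_sq[of _ d] minus_scalar_prod_distrib[of _ d]
          scalar_prod_minus_distrib[of _ d])
    then have "scalar_prod (p - c) (p - y) / \<eta> =
        ((vnorm (p - c))\<^sup>2 + (vnorm (y - p))\<^sup>2 - (vnorm (y - c))\<^sup>2) / (2 * \<eta>)"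
      using \<eta> by (simp add: field_simps)
    moreover have "scalar_prod s (y - p) = scalar_prod v (p - y) + scalar_prod (p - c) (p - y) / \<eta>"
      using p cc yc v by (simp add: s_prod[OF yc] scalar_prod_minus_distrib[of _ d] diff_divide_distrib)
    ultimately show ?thesis by simp
  qed
  ultimately show ?thesis by linarith
qed

text \<open>Adding the three-point inequalities of two proximal steps, each tested at the other's
  result, shows that strong convexity of \<open>\<psi>\<close> makes the step a contraction by \<open>1 / (1 + \<mu> \<eta>)\<close>.\<close>

lemma prox_contraction:
  assumes min: "is_arg_min (\<lambda>y. \<psi> y + ereal (scalar_prod v y) + ereal ((vnorm (y - c))\<^sup>2 / (2 * \<eta>)))
                  (\<lambda>y. y \<in> carrier_vec d) p"
    and min': "is_arg_min (\<lambda>y. \<psi> y + ereal (scalar_prod v' y) + ereal ((vnorm (y - c'))\<^sup>2 / (2 * \<eta>)))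
                  (\<lambda>y. y \<in> carrier_vec d) p'"
    and c: "c \<in> edom d \<psi>" "c' \<in> edom d \<psi>" and v: "v \<in> carrier_vec d" "v' \<in> carrier_vec d"
    and \<eta>: "\<eta> > 0"
  shows "((1 + \<mu> * \<eta>) * vnorm (p - p'))\<^sup>2
          \<le> (vnorm (c - c'))\<^sup>2 - 2 * \<eta> * scalar_prod (v - v') (c - c') + \<eta>\<^sup>2 * (vnorm (v - v'))\<^sup>2"
proof -
  have pd: "p \<in> edom d \<psi>" "p' \<in> edom d \<psi>"
    using prox_optimality(1)[OF min c(1) v(1) \<eta>] prox_optimality(1)[OF min' c(2) v(2) \<eta>] by auto
  have car: "p \<in> carrier_vec d" "p' \<in> carrier_vec d" "c \<in> carrier_vec d" "c' \<in> carrier_vec d"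
    using pd c edom_carrier by auto
  define r where "r = (c - c') - \<eta> \<cdot>\<^sub>v (v - v')"
  have rc: "r \<in> carrier_vec d" using car v by (simp add: r_def)
  have r_prod: "scalar_prod r w = scalar_prod (c - c') w - \<eta> * scalar_prod (v - v') w"
    if "w \<in> carrier_vec d" for w
    using that car v by (simp add: r_def minus_scalar_prod_distrib[of "c - c'" d])
  let ?D = "vnorm (p - p')"
  have sym: "vnorm (p' - p) = ?D" using vnorm_minus_commute[OF car(2,1)] .
  have "scalar_prod v (p - p') + scalar_prod v' (p' - p)
      + ((vnorm (p - c))\<^sup>2 + ?D\<^sup>2 - (vnorm (p' - c))\<^sup>2
         + ((vnorm (p' - c'))\<^sup>2 + ?D\<^sup>2 - (vnorm (p - c'))\<^sup>2)) / (2 * \<eta>) + \<mu> * ?D\<^sup>2 \<le> 0"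
    using prox_three_point[OF min c(1) v(1) \<eta> pd(2)] prox_three_point[OF min' c(2) v(2) \<eta> pd(1)]
    unfolding sym by (simp add: add_divide_distrib diff_divide_distrib)
  moreover have "(vnorm (p - c))\<^sup>2 + ?D\<^sup>2 - (vnorm (p' - c))\<^sup>2
         + ((vnorm (p' - c'))\<^sup>2 + ?D\<^sup>2 - (vnorm (p - c'))\<^sup>2)
       = 2 * (?D\<^sup>2 - scalar_prod (c - c') (p - p'))"
    using car comm_scalar_prod[OF car(1,3)] comm_scalar_prod[OF car(1,4)]
      comm_scalar_prod[OF car(2,3)] comm_scalar_prod[OF car(2,4)]
    by (simp add: vnorm_minus_sq[of _ d] minus_scalar_prod_distrib[of _ d]
          scalar_prod_minus_distrib[of _ d])
  moreover have "scalar_prod v (p - p') + scalar_prod v' (p' - p) = scalar_prod (v - v') (p - p')"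
    using car v by (simp add: minus_scalar_prod_distrib[of _ d] scalar_prod_minus_distrib[of _ d])
  ultimately have "scalar_prod (v - v') (p - p') + (?D\<^sup>2 - scalar_prod (c - c') (p - p')) / \<eta>
      + \<mu> * ?D\<^sup>2 \<le> 0"
    by (simp only: mult_divide_mult_cancel_left_if) simp
  then have "\<eta> * (scalar_prod (v - v') (p - p') + (?D\<^sup>2 - scalar_prod (c - c') (p - p')) / \<eta>
      + \<mu> * ?D\<^sup>2) \<le> 0"
    using \<eta> by (simp add: mult_le_0_iff)
  then have "(1 + \<mu> * \<eta>) * ?D\<^sup>2 \<le> scalar_prod r (p - p')"
    using \<eta> car by (simp add: r_prod distrib_left distrib_right) (simp add: algebra_simps)
  also have "\<dots> \<le> vnorm r * ?D"
    using abs_scalar_prod_le[OF rc, of "p - p'"] car by simp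
  finally have "((1 + \<mu> * \<eta>) * ?D) * ?D \<le> vnorm r * ?D" by (simp add: power2_eq_square)
  moreover have "0 \<le> ?D" by simp
  ultimately have le: "(1 + \<mu> * \<eta>) * ?D \<le> vnorm r"
    by (cases "?D = 0") auto
  have "((1 + \<mu> * \<eta>) * ?D)\<^sup>2 \<le> (vnorm r)\<^sup>2"
    using le \<mu>_pos \<eta> by (intro power_mono) auto
  also have "(vnorm r)\<^sup>2 = (vnorm (c - c'))\<^sup>2 - 2 * \<eta> * scalar_prod (v - v') (c - c')
       + \<eta>\<^sup>2 * (vnorm (v - v'))\<^sup>2"
  proof -
    have vc: "v - v' \<in> carrier_vec d" and ccc: "c - c' \<in> carrier_vec d" using v car by auto
    show ?thesis
      using vc ccc comm_scalar_prod[OF vc ccc] unfolding r_def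
      by (subst vnorm_minus_sq[of _ d]) (auto simp: vnorm_sq, simp add: power2_eq_square)
  qed
  finally show ?thesis .
qed

end


section \<open>Epochs and the reshuffling law\<close>

lemma epoch_eq:
  assumes "n \<ge> 1" "t \<ge> 1"
  shows "epoch n t = Suc ((t - 1) div n)"
proof -
  define q r where "q = (t - 1) div n" and "r = (t - 1) mod n"
  have t: "real t = real q * real n + real r + 1"
    using assms(2) div_mult_mod_eq[of "t - 1" n] unfolding q_def r_def
    by (simp flip: of_nat_mult of_nat_add of_nat_Suc)
  have r: "real r + 1 \<le> real n"
    using assms(1) mod_less_divisor[of n "t - 1"] unfolding r_def by linarith
  have "\<lceil>real t / real n\<rceil> = int (Suc q)"
    using assms(1) r by (intro ceiling_unique) (auto simp: t field_simps)
  then show ?thesis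
    by (simp add: epoch_def q_def)
qed

lemma epoch_pos_eq:
  assumes "n \<ge> 1" "t \<ge> 1"
  shows "epoch_pos n t = Suc ((t - 1) mod n)"
  using assms div_mult_mod_eq[of "t - 1" n] unfolding epoch_pos_def epoch_eq[OF assms]
  by (simp only: diff_Suc_1)

lemma epoch_decomposition:
  assumes "n \<ge> 1" "t \<ge> 1"
  shows "t = (epoch n t - 1) * n + epoch_pos n t" and "epoch_pos n t \<in> {1..n}"
proof -
  show "t = (epoch n t - 1) * n + epoch_pos n t"
    using assms div_mult_mod_eq[of "t - 1" n] unfolding epoch_eq[OF assms] epoch_pos_eq[OF assms]
    by simp
  show "epoch_pos n t \<in> {1..n}"
    using assms mod_less_divisor[of n "t - 1"] unfolding epoch_pos_eq[OF assms]
    by (auto simp: Suc_le_eq simp del: mod_less_divisor)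
qed

lemma epoch_composition:
  assumes "n \<ge> 1" "q \<ge> 1" "j \<in> {1..n}"
  shows "epoch n ((q - 1) * n + j) = q"
proof -
  have ge: "(q - 1) * n + j \<ge> 1" using assms by auto
  have "(q - 1) * n + j - 1 = (j - 1) + (q - 1) * n" using assms by auto
  then have "((q - 1) * n + j - 1) div n = q - 1"
    using assms by (simp_all only: div_mult_self1) auto
  then show ?thesis
    using assms ge by (simp add: epoch_eq)
qed

lemma epoch_mono: "n \<ge> 1 \<Longrightarrow> 1 \<le> s \<Longrightarrow> s \<le> t \<Longrightarrow> epoch n s \<le> epoch n t"
  by (simp add: epoch_eq div_le_mono diff_le_mono)

lemma rr_pmf_eq:
  "rr_pmf n K = pmf_of_set (PiE_dflt {1..K} id (\<lambda>_. {\<pi>. \<pi> permutes {1..n}}))"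
  unfolding rr_pmf_def
  by (intro Pi_pmf_of_set) (auto simp: finite_permutations intro: exI[of _ id] permutes_id)

lemma rr_outcomes_finite: "finite (PiE_dflt {1..K::nat} id (\<lambda>_. {\<pi>. \<pi> permutes {1..n::nat}}))"
  by (intro finite_PiE_dflt) (auto simp: finite_permutations)

lemma rr_outcomes_nonempty: "PiE_dflt {1..K::nat} id (\<lambda>_. {\<pi>. \<pi> permutes {1..n::nat}}) \<noteq> {}"
proof -
  have "(\<lambda>_. id) \<in> PiE_dflt {1..K} id (\<lambda>_. {\<pi>. \<pi> permutes {1..n}})"
    by (auto simp: PiE_dflt_def permutes_id)
  then show ?thesis by blast
qed

lemma set_rr_pmf: "set_pmf (rr_pmf n K) = PiE_dflt {1..K} id (\<lambda>_. {\<pi>. \<pi> permutes {1..n}})"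
  unfolding rr_pmf_eq using rr_outcomes_finite rr_outcomes_nonempty by (intro set_pmf_of_set)

lemma finite_set_rr_pmf: "finite (set_pmf (rr_pmf n K))"
  using rr_outcomes_finite unfolding set_rr_pmf .

lemma rr_pmf_permutes: "\<omega> \<in> set_pmf (rr_pmf n K) \<Longrightarrow> q \<in> {1..K} \<Longrightarrow> \<omega> q permutes {1..n}"
  by (auto simp: set_rr_pmf PiE_dflt_def)

text \<open>Right composition acts on the positions: the values at positions \<open>a\<close> and \<open>b\<close> of the \<open>q\<close>-th
  permutation trade places.\<close>

definition swap_entries ::
  "nat \<Rightarrow> nat \<Rightarrow> nat \<Rightarrow> (nat \<Rightarrow> nat \<Rightarrow> nat) \<Rightarrow> (nat \<Rightarrow> nat \<Rightarrow> nat)" where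
  "swap_entries q a b \<omega> = fun_upd \<omega> q (\<omega> q \<circ> Transposition.transpose a b)"

lemma swap_entries_in_rr:
  assumes "\<omega> \<in> set_pmf (rr_pmf n K)" "a \<in> {1..n}" "b \<in> {1..n}" "q \<in> {1..K}"
  shows "swap_entries q a b \<omega> \<in> set_pmf (rr_pmf n K)"
proof -
  have "\<omega> q \<circ> Transposition.transpose a b permutes {1..n}"
    using assms by (intro permutes_compose permutes_swap_id rr_pmf_permutes)
  then show ?thesis
    using assms by (auto simp: set_rr_pmf PiE_dflt_def swap_entries_def)
qed

lemma swap_entries_involutive: "swap_entries q a b (swap_entries q a b \<omega>) = \<omega>"
  by (auto simp: swap_entries_def fun_eq_iff)

lemma map_pmf_swap_entries:
  assumes "a \<in> {1..n}" "b \<in> {1..n}" "q \<in> {1..K}"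
  shows "map_pmf (swap_entries q a b) (rr_pmf n K) = rr_pmf n K"
proof -
  have "bij_betw (swap_entries q a b) (set_pmf (rr_pmf n K)) (set_pmf (rr_pmf n K))"
    using swap_entries_in_rr[OF _ assms]
    by (intro bij_betwI[where g = "swap_entries q a b"]) (auto simp: swap_entries_involutive)
  then show ?thesis
    using rr_outcomes_finite rr_outcomes_nonempty unfolding set_rr_pmf
    unfolding rr_pmf_eq by (intro map_pmf_of_set_bij_betw)
qed

lemma rr_index_swap_other:
  assumes "n \<ge> 1" "q \<ge> 1" "s \<ge> 1" "s \<noteq> (q - 1) * n + a" "s \<noteq> (q - 1) * n + b"
  shows "rr_index n (swap_entries q a b \<omega>) s = rr_index n \<omega> s"
proof (cases "epoch n s = q")
  case True
  then have "epoch_pos n s \<noteq> a" "epoch_pos n s \<noteq> b"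
    using epoch_decomposition(1)[OF assms(1,3)] assms(4,5) by auto
  then show ?thesis by (simp add: rr_index_def swap_entries_def transpose_apply_other)
qed (simp add: rr_index_def swap_entries_def)

lemma rr_index_range:
  assumes "\<omega> \<in> set_pmf (rr_pmf n (epoch n T))" "n \<ge> 1" "t \<in> {1..T}"
  shows "rr_index n \<omega> t \<in> {1..n}"
proof -
  have "epoch n t \<in> {1..epoch n T}"
    using assms epoch_mono[of n t T] by (auto simp: epoch_eq)
  then show ?thesis
    using rr_pmf_permutes[OF assms(1)] epoch_decomposition(2)[of n t] assms(2,3)
      permutes_in_image[of "\<omega> (epoch n t)" "{1..n}" "epoch_pos n t"]
    by (simp add: rr_index_def)
qed

lemma rr_index_inj:
  assumes "\<omega> \<in> set_pmf (rr_pmf n K)" "n \<ge> 1" "q \<in> {1..K}" "\<And>s. s \<in> S \<Longrightarrow> s \<ge> 1 \<and> epoch n s = q"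
  shows "inj_on (rr_index n \<omega>) S"
proof (rule inj_onI)
  fix s s' assume s: "s \<in> S" "s' \<in> S" "rr_index n \<omega> s = rr_index n \<omega> s'"
  have "\<omega> q permutes {1..n}" using rr_pmf_permutes assms by blast
  then have "inj (\<omega> q)" by (rule permutes_inj)
  with s assms(4) have "epoch_pos n s = epoch_pos n s'"
    by (auto simp: rr_index_def dest: injD)
  then show "s = s'"
    using s assms(2,4) epoch_decomposition(1)[of n s] epoch_decomposition(1)[of n s'] by metis
qed

text \<open>Exchangeability. Averaging \<open>\<phi>\<close> over all \<open>n\<close> components is averaging over the \<open>n\<close> entries of the
  permutation in use at time \<open>t\<close>; transposing entry \<open>j\<close> with the one read at time \<open>t\<close> preserves
  the law and moves entry \<open>j\<close> to time \<open>t\<close>. So uniform sampling differs from the sampled index only through the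
  effect of one transposition on the remaining dependence on \<open>\<omega>\<close>.\<close>

lemma rr_exchange:
  fixes \<phi> :: "nat \<Rightarrow> (nat \<Rightarrow> nat \<Rightarrow> nat) \<Rightarrow> real"
  assumes n: "n \<ge> 1" and t: "t \<in> {1..T}"
  shows "measure_pmf.expectation (rr_pmf n (epoch n T)) (\<lambda>\<omega>. (\<Sum>i=1..n. \<phi> i \<omega>) / n)
       = (\<Sum>j=1..n. measure_pmf.expectation (rr_pmf n (epoch n T))
            (\<lambda>\<omega>. \<phi> (rr_index n \<omega> t) (swap_entries (epoch n t) j (epoch_pos n t) \<omega>))) / n"
proof -
  let ?P = "rr_pmf n (epoch n T)" and ?q = "epoch n t" and ?r = "epoch_pos n t"
  have q: "?q \<in> {1..epoch n T}"
    using assms epoch_mono[of n t T] by (auto simp: epoch_eq)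
  have r: "?r \<in> {1..n}" using epoch_decomposition(2) assms by simp
  have int [simp]: "integrable (measure_pmf ?P) h" for h :: "_ \<Rightarrow> real"
    by (intro integrable_measure_pmf_finite finite_set_rr_pmf)
  have "measure_pmf.expectation ?P (\<lambda>\<omega>. (\<Sum>i=1..n. \<phi> i \<omega>) / n)
      = measure_pmf.expectation ?P (\<lambda>\<omega>. (\<Sum>j=1..n. \<phi> (\<omega> ?q j) \<omega>) / n)"
  proof (intro Bochner_Integration.integral_cong_AE)
    show "AE \<omega> in measure_pmf ?P. (\<Sum>i=1..n. \<phi> i \<omega>) / n = (\<Sum>j=1..n. \<phi> (\<omega> ?q j) \<omega>) / n"
    proof (rule AE_pmfI)
      fix \<omega> assume "\<omega> \<in> set_pmf ?P"
      then show "(\<Sum>i=1..n. \<phi> i \<omega>) / n = (\<Sum>j=1..n. \<phi> (\<omega> ?q j) \<omega>) / n"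
        using sum.permute[OF rr_pmf_permutes[OF _ q], of \<omega> n "\<lambda>i. \<phi> i \<omega>"] by simp
    qed
  qed auto
  also have "\<dots> = (\<Sum>j=1..n. measure_pmf.expectation ?P (\<lambda>\<omega>. \<phi> (\<omega> ?q j) \<omega>)) / n"
    by simp
  also have "\<dots> = (\<Sum>j=1..n. measure_pmf.expectation ?P
            (\<lambda>\<omega>. \<phi> (rr_index n \<omega> t) (swap_entries ?q j ?r \<omega>))) / n"
  proof -
    have "measure_pmf.expectation ?P (\<lambda>\<omega>. \<phi> (\<omega> ?q j) \<omega>)
        = measure_pmf.expectation ?P (\<lambda>\<omega>. \<phi> (rr_index n \<omega> t) (swap_entries ?q j ?r \<omega>))"
      if j: "j \<in> {1..n}" for j
    proof -
      have entry: "swap_entries ?q j ?r \<omega> ?q j = rr_index n \<omega> t" for \<omega>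
        by (simp add: rr_index_def swap_entries_def)
      have "measure_pmf.expectation ?P (\<lambda>\<omega>. \<phi> (\<omega> ?q j) \<omega>)
         = measure_pmf.expectation (map_pmf (swap_entries ?q j ?r) ?P) (\<lambda>\<omega>. \<phi> (\<omega> ?q j) \<omega>)"
        by (simp only: map_pmf_swap_entries[OF j r q])
      also have "\<dots> = measure_pmf.expectation ?P
           (\<lambda>\<omega>. \<phi> (rr_index n \<omega> t) (swap_entries ?q j ?r \<omega>))"
        by (simp only: integral_map_pmf entry)
      finally show ?thesis .
    qed
    then show ?thesis by simp
  qed
  finally show ?thesis .
qed


section \<open>Stability of the iterates under exchanging two indices\<close>

locale prox_subgradient_method = strongly_convex_prox d \<psi> \<mu>
  for d :: nat and \<psi> :: "real vec \<Rightarrow> ereal" and \<mu> :: real +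
  fixes n m T :: nat and f :: "nat \<Rightarrow> real vec \<Rightarrow> real" and g :: "nat \<Rightarrow> real vec \<Rightarrow> real vec"
    and G :: "nat \<Rightarrow> real" and x1 :: "real vec"
  assumes n: "n \<ge> 1" and m: "m \<ge> 1"
    and f_conv: "\<And>i. i \<in> {1..n} \<Longrightarrow> convex_fun d (\<lambda>y. ereal (f i y))"
    and g_sub: "\<And>i y. i \<in> {1..n} \<Longrightarrow> y \<in> carrier_vec d \<Longrightarrow> g i y \<in> subdiff d (\<lambda>w. ereal (f i w)) y"
    and G_pos: "\<And>i. i \<in> {1..n} \<Longrightarrow> G i > 0"
    and lip: "\<And>i. i \<in> {1..n} \<Longrightarrow> lipschitz_with_subgrad (edom d \<psi>) (G i) (f i) (g i)"
    and x1: "x1 \<in> edom d \<psi>"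
begin

abbreviation \<eta> :: "nat \<Rightarrow> real" where "\<eta> t \<equiv> real m / (\<mu> * real t)"

abbreviation "run idx X \<equiv> prox_gradient_iterates d \<psi> g \<eta> T x1 idx X"

lemma g_carrier: "i \<in> {1..n} \<Longrightarrow> y \<in> carrier_vec d \<Longrightarrow> g i y \<in> carrier_vec d"
  using g_sub by (auto simp: subdiff_def)

lemma g_subgradient:
  "i \<in> {1..n} \<Longrightarrow> y \<in> carrier_vec d \<Longrightarrow> w \<in> carrier_vec d
    \<Longrightarrow> f i y + scalar_prod (g i y) (w - y) \<le> f i w"
  using g_sub[of i y] by (auto simp: subdiff_def)

lemma g_norm: "i \<in> {1..n} \<Longrightarrow> y \<in> edom d \<psi> \<Longrightarrow> vnorm (g i y) \<le> G i"
  using lip by (auto simp: lipschitz_with_subgrad_def)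

lemma f_lipschitz:
  "i \<in> {1..n} \<Longrightarrow> y \<in> edom d \<psi> \<Longrightarrow> w \<in> edom d \<psi> \<Longrightarrow> \<bar>f i y - f i w\<bar> \<le> G i * vnorm (y - w)"
  using lip by (auto simp: lipschitz_with_subgrad_def)

lemma g_monotone:
  assumes i: "i \<in> {1..n}" and y: "y \<in> carrier_vec d" and w: "w \<in> carrier_vec d"
  shows "0 \<le> scalar_prod (g i y - g i w) (y - w)"
proof -
  have g: "g i y \<in> carrier_vec d" "g i w \<in> carrier_vec d" using g_carrier i y w by auto
  have "scalar_prod (g i y - g i w) (y - w)
      = - scalar_prod (g i y) (w - y) - scalar_prod (g i w) (y - w)"
    using g y w by (simp add: minus_scalar_prod_distrib[of _ d] scalar_prod_minus_distrib[of _ d])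
  then show ?thesis
    using g_subgradient[OF i y w] g_subgradient[OF i w y] by linarith
qed

lemma \<eta>_pos: "t \<ge> 1 \<Longrightarrow> \<eta> t > 0"
  using m \<mu>_pos by simp

lemma run_step:
  assumes "run idx X" "t \<in> {1..T}"
  shows "is_arg_min (\<lambda>y. \<psi> y + ereal (scalar_prod (g (idx t) (X t)) y)
            + ereal ((vnorm (y - X t))\<^sup>2 / (2 * \<eta> t))) (\<lambda>y. y \<in> carrier_vec d) (X (Suc t))"
  using assms by (simp add: prox_gradient_iterates_def)

lemma run_edom:
  assumes run: "run idx X" and idx: "\<And>t. t \<in> {1..T} \<Longrightarrow> idx t \<in> {1..n}" and t: "t \<in> {1..Suc T}"
  shows "X t \<in> edom d \<psi>"
proof -
  have "1 \<le> t" using t by simp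
  then show ?thesis using t
  proof (induction t rule: dec_induct)
    case base
    then show ?case using run x1 by (simp add: prox_gradient_iterates_def)
  next
    case (step s)
    then have s: "s \<in> {1..T}" and X: "X s \<in> edom d \<psi>" by auto
    show ?case
      using prox_optimality(1)[OF run_step[OF run s] X g_carrier[OF idx[OF s] edom_carrier[OF X]]]
        \<eta>_pos[of s] s by simp
  qed
qed

text \<open>Two runs from the same point stay together while they use the same indices; a common index
  lets them separate only by the bounded jump of a monotone subgradient, and distinct indices at a
  common point only by the sizes of two subgradients. Since \<open>1 + \<mu> \<eta> t = (t + m) / t\<close>, the
  contraction of the proximal step beats the growth of the factor \<open>t\<close>, so that the scaled distance
  \<open>t \<parallel>X t - Y t\<parallel>\<close> accumulates square increments without weights.\<close>

lemma run_distance_step: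
  assumes X: "run a X" and Y: "run b Y"
    and a: "\<And>t. t \<in> {1..T} \<Longrightarrow> a t \<in> {1..n}" and b: "\<And>t. t \<in> {1..T} \<Longrightarrow> b t \<in> {1..n}"
    and t: "t \<in> {1..T}" and same: "a t = b t \<or> X t = Y t"
  shows "(real (Suc t) * vnorm (X (Suc t) - Y (Suc t)))\<^sup>2
     \<le> (real t * vnorm (X t - Y t))\<^sup>2 + 2 * (real m / \<mu>)\<^sup>2 * ((G (a t))\<^sup>2 + (G (b t))\<^sup>2)"
    and "a t = b t \<Longrightarrow> X t = Y t \<Longrightarrow> X (Suc t) = Y (Suc t)"
proof -
  have dom: "X t \<in> edom d \<psi>" "Y t \<in> edom d \<psi>" "X (Suc t) \<in> edom d \<psi>" "Y (Suc t) \<in> edom d \<psi>"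
    using run_edom[OF X a] run_edom[OF Y b] t by auto
  note car = this[THEN edom_carrier]
  have gc: "g (a t) (X t) \<in> carrier_vec d" "g (b t) (Y t) \<in> carrier_vec d"
    using g_carrier a b t car by auto
  have \<eta>: "\<eta> t > 0" using \<eta>_pos t by simp
  let ?u = "g (a t) (X t)" and ?v = "g (b t) (Y t)"
  let ?D = "vnorm (X t - Y t)" and ?D' = "vnorm (X (Suc t) - Y (Suc t))"
  note contr = prox_contraction[OF run_step[OF X t] run_step[OF Y t] dom(1,2) gc \<eta>]
  have zero: "scalar_prod w (Y t - Y t) = 0" if "w \<in> carrier_vec d" for w
    using that car by (simp add: scalar_prod_minus_distrib[of _ d])
  have "0 \<le> scalar_prod (?u - ?v) (X t - Y t)"
    using same
  proof
    assume "a t = b t"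
    then show ?thesis using g_monotone[of "b t"] b t car by simp
  next
    assume "X t = Y t"
    then show ?thesis using zero[of "?u - ?v"] gc by simp
  qed
  then have "0 \<le> 2 * \<eta> t * scalar_prod (?u - ?v) (X t - Y t)"
    using \<eta> by (intro mult_nonneg_nonneg) auto
  moreover have jump: "(vnorm (?u - ?v))\<^sup>2 \<le> 2 * ((G (a t))\<^sup>2 + (G (b t))\<^sup>2)"
    using vnorm_minus_sq_le[OF gc] power_mono[OF g_norm[OF a[OF t] dom(1)], of 2]
      power_mono[OF g_norm[OF b[OF t] dom(2)], of 2] by simp
  then have "(\<eta> t)\<^sup>2 * (vnorm (?u - ?v))\<^sup>2 \<le> (\<eta> t)\<^sup>2 * (2 * ((G (a t))\<^sup>2 + (G (b t))\<^sup>2))"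
    by (intro mult_left_mono) auto
  ultimately have "((1 + \<mu> * \<eta> t) * ?D')\<^sup>2 \<le> ?D\<^sup>2 + (\<eta> t)\<^sup>2 * (2 * ((G (a t))\<^sup>2 + (G (b t))\<^sup>2))"
    using contr by linarith
  then have "(real t)\<^sup>2 * ((1 + \<mu> * \<eta> t) * ?D')\<^sup>2
      \<le> (real t)\<^sup>2 * (?D\<^sup>2 + (\<eta> t)\<^sup>2 * (2 * ((G (a t))\<^sup>2 + (G (b t))\<^sup>2)))"
    by (intro mult_left_mono) auto
  moreover have "real t * ((1 + \<mu> * \<eta> t) * ?D') = (real t + real m) * ?D'"
    using t \<mu>_pos by (simp add: field_simps)
  then have "(real t)\<^sup>2 * ((1 + \<mu> * \<eta> t) * ?D')\<^sup>2 = ((real t + real m) * ?D')\<^sup>2"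
    by (simp only: power_mult_distrib[symmetric])
  moreover have "(real t)\<^sup>2 * (?D\<^sup>2 + (\<eta> t)\<^sup>2 * (2 * ((G (a t))\<^sup>2 + (G (b t))\<^sup>2)))
     = (real t * ?D)\<^sup>2 + 2 * (real m / \<mu>)\<^sup>2 * ((G (a t))\<^sup>2 + (G (b t))\<^sup>2)"
  proof -
    have "(real t)\<^sup>2 * (\<eta> t)\<^sup>2 = (real m / \<mu>)\<^sup>2"
      using t by (simp add: power_divide power_mult_distrib)
    then show ?thesis
      by (simp only: distrib_left mult.assoc[symmetric] power_mult_distrib)
  qed
  moreover have "(real (Suc t) * ?D')\<^sup>2 \<le> ((real t + real m) * ?D')\<^sup>2"
    using m by (intro power_mono mult_right_mono) auto
  ultimately show "(real (Suc t) * ?D')\<^sup>2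
     \<le> (real t * ?D)\<^sup>2 + 2 * (real m / \<mu>)\<^sup>2 * ((G (a t))\<^sup>2 + (G (b t))\<^sup>2)"
    by linarith
  assume eq: "a t = b t" "X t = Y t"
  have "vnorm (Y t - Y t) = 0" "vnorm (?v - ?v) = 0"
    using zero[of "Y t - Y t"] gc(2) car unfolding vnorm_def
    by (auto simp: scalar_prod_minus_distrib[of _ d])
  then have "((1 + \<mu> * \<eta> t) * ?D')\<^sup>2 \<le> 0"
    using contr zero[of "?v - ?v"] gc unfolding eq by simp
  then have "(1 + \<mu> * \<eta> t) * ?D' = 0" by simp
  moreover have "1 + \<mu> * \<eta> t > 0" using mult_pos_pos[OF \<mu>_pos \<eta>] by linarith
  ultimately have "?D' = 0" by simp
  then show "X (Suc t) = Y (Suc t)"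
    by (rule vnorm_minus_eq_0[OF car(3,4)])
qed

lemma run_cong:
  assumes X: "run a X" and Y: "run b Y"
    and a: "\<And>t. t \<in> {1..T} \<Longrightarrow> a t \<in> {1..n}" and b: "\<And>t. t \<in> {1..T} \<Longrightarrow> b t \<in> {1..n}"
    and k: "k \<in> {1..Suc T}" and same: "\<And>s. 1 \<le> s \<Longrightarrow> s < k \<Longrightarrow> a s = b s"
  shows "X k = Y k"
proof -
  have "1 \<le> k" using k by simp
  then show ?thesis using k same
  proof (induction k rule: dec_induct)
    case base
    then show ?case using X Y by (simp add: prox_gradient_iterates_def)
  next
    case (step s)
    then show ?case
      using run_distance_step(2)[OF X Y a b, of s] by simp
  qed
qed

lemma sum_sq_lip_injective:
  assumes "inj_on a S" "a ` S \<subseteq> {1..n}"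
  shows "(\<Sum>s\<in>S. (G (a s))\<^sup>2) \<le> real n * (rms_lip n G)\<^sup>2"
proof -
  have "(\<Sum>s\<in>S. (G (a s))\<^sup>2) = (\<Sum>i\<in>a ` S. (G i)\<^sup>2)"
    using sum.reindex[OF assms(1), of "\<lambda>i. (G i)\<^sup>2"] by simp
  also have "\<dots> \<le> (\<Sum>i=1..n. (G i)\<^sup>2)"
    using assms(2) by (intro sum_mono2) auto
  also have "\<dots> = real n * (rms_lip n G)\<^sup>2"
    using n by (simp add: rms_lip_def sum_nonneg)
  finally show ?thesis .
qed

text \<open>Without smoothness the runs separate like the root of the sum of squared increments,
  instead of the sum of the increments, so one epoch costs \<open>\<surd>n\<close> and not \<open>n\<close>.\<close>

lemma run_stability:
  assumes X: "run a X" and Y: "run b Y"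
    and a: "\<And>t. t \<in> {1..T} \<Longrightarrow> a t \<in> {1..n}" and b: "\<And>t. t \<in> {1..T} \<Longrightarrow> b t \<in> {1..n}"
    and j: "1 \<le> j" and k: "j \<le> k" "k \<in> {1..T}"
    and same: "\<And>s. 1 \<le> s \<Longrightarrow> s < k \<Longrightarrow> s \<noteq> j \<Longrightarrow> a s = b s"
    and inj: "inj_on a {j..<k}" "inj_on b {j..<k}"
  shows "vnorm (X k - Y k) \<le> 2 * \<eta> k * (sqrt (real n) * rms_lip n G)"
proof -
  have jT: "j \<in> {1..Suc T}" using j k by auto
  have XYj: "X j = Y j"
    using same k by (intro run_cong[OF X Y a b jT]) auto
  have Yj: "Y j \<in> carrier_vec d" using run_edom[OF Y b jT] edom_carrier by simp
  have "(real l * vnorm (X l - Y l))\<^sup>2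
      \<le> 2 * (real m / \<mu>)\<^sup>2 * (\<Sum>s=j..<l. (G (a s))\<^sup>2 + (G (b s))\<^sup>2)" if "l \<in> {j..k}" for l
  proof -
    have "j \<le> l" using that by simp
    then show ?thesis using that
    proof (induction l rule: dec_induct)
      case base
      then show ?case using Yj by (simp add: XYj vnorm_def scalar_prod_minus_distrib[of _ d])
    next
      case (step s)
      then have s: "s \<in> {1..T}" and "s < k" using k j by auto
      have "a s = b s \<or> X s = Y s"
        using same[of s] XYj s \<open>s < k\<close> by (cases "s = j") auto
      from run_distance_step(1)[OF X Y a b s this] step show ?case
        by (simp add: sum.atLeastLessThan_Suc distrib_left)
    qed
  qed
  from this[of k] k have "(real k * vnorm (X k - Y k))\<^sup>2
      \<le> 2 * (real m / \<mu>)\<^sup>2 * ((\<Sum>s=j..<k. (G (a s))\<^sup>2) + (\<Sum>s=j..<k. (G (b s))\<^sup>2))"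
    by (simp add: sum.distrib)
  also have "\<dots> \<le> 2 * (real m / \<mu>)\<^sup>2 * (real n * (rms_lip n G)\<^sup>2 + real n * (rms_lip n G)\<^sup>2)"
    using a b j k by (intro mult_left_mono add_mono sum_sq_lip_injective inj) auto
  also have "\<dots> = (2 * (real m / \<mu>) * (sqrt (real n) * rms_lip n G))\<^sup>2"
    by (simp add: power_mult_distrib power_divide)
  finally have "real k * vnorm (X k - Y k) \<le> 2 * (real m / \<mu>) * (sqrt (real n) * rms_lip n G)"
    by (rule power2_le_imp_le) (use \<mu>_pos in \<open>simp add: rms_lip_def sum_nonneg\<close>)
  then show ?thesis
    using k \<mu>_pos by (simp add: field_simps)
qed

end


section \<open>The bias of sampling without replacement\<close>

locale random_reshuffling = prox_subgradient_method d \<psi> \<mu> n m T f g G x1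
  for d :: nat and \<psi> :: "real vec \<Rightarrow> ereal" and \<mu> :: real and n m T :: nat
    and f :: "nat \<Rightarrow> real vec \<Rightarrow> real" and g :: "nat \<Rightarrow> real vec \<Rightarrow> real vec"
    and G :: "nat \<Rightarrow> real" and x1 :: "real vec" +
  fixes x :: "(nat \<Rightarrow> nat \<Rightarrow> nat) \<Rightarrow> nat \<Rightarrow> real vec"
  assumes T: "T \<ge> 1"
    and runs: "\<And>\<omega>. \<omega> \<in> set_pmf (rr_pmf n (epoch n T)) \<Longrightarrow>
      prox_gradient_iterates d \<psi> g (\<lambda>t. real m / (\<mu> * real t)) T x1 (rr_index n \<omega>) (x \<omega>)"
begin

abbreviation "\<Omega> \<equiv> set_pmf (rr_pmf n (epoch n T))"
abbreviation "E \<equiv> measure_pmf.expectation (rr_pmf n (epoch n T))"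
abbreviation "idx \<equiv> rr_index n"

definition fbar :: "real vec \<Rightarrow> real" where "fbar y = (\<Sum>i=1..n. f i y) / real n"

text \<open>The price of one epoch per unit step size: a swap displaces the iterate by
  at most \<open>2 * \<surd>n * rms_lip n G\<close> step sizes, and the component evaluated there has Lipschitz constant
  \<open>mean_lip n G\<close> on average.\<close>

definition noise :: real where "noise = sqrt (real n) * mean_lip n G * rms_lip n G"

lemma integrable [simp]: "integrable (measure_pmf (rr_pmf n (epoch n T))) h"
  for h :: "(nat \<Rightarrow> nat \<Rightarrow> nat) \<Rightarrow> real"
  by (intro integrable_measure_pmf_finite finite_set_rr_pmf)

lemma E_mono: "(\<And>\<omega>. \<omega> \<in> \<Omega> \<Longrightarrow> h \<omega> \<le> h' \<omega>) \<Longrightarrow> E h \<le> E h'" for h h' :: "_ \<Rightarrow> real"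
  by (intro integral_mono_AE) (auto intro: AE_pmfI)

lemma idx_range: "\<omega> \<in> \<Omega> \<Longrightarrow> t \<in> {1..T} \<Longrightarrow> idx \<omega> t \<in> {1..n}"
  using rr_index_range n by blast

lemma x_edom: "\<omega> \<in> \<Omega> \<Longrightarrow> t \<in> {1..Suc T} \<Longrightarrow> x \<omega> t \<in> edom d \<psi>"
  using run_edom[OF runs idx_range] .

lemma E_uniform_index:
  fixes c :: "nat \<Rightarrow> real"
  assumes "t \<in> {1..T}"
  shows "E (\<lambda>\<omega>. c (idx \<omega> t)) = (\<Sum>i=1..n. c i) / real n"
proof -
  have "(\<Sum>i=1..n. c i) / real n = E (\<lambda>\<omega>. (\<Sum>i=1..n. c i) / real n)" by simp
  also have "\<dots> = (\<Sum>j=1..n. E (\<lambda>\<omega>. c (idx \<omega> t))) / real n"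
    using rr_exchange[OF n assms, of "\<lambda>i \<omega>. c i"] by simp
  also have "\<dots> = E (\<lambda>\<omega>. c (idx \<omega> t))" using n by simp
  finally show ?thesis by simp
qed

text \<open>Swapping the index read at time \<open>t\<close> with another one of the same epoch changes what the iterate
  at time \<open>k \<le> t\<close> has seen in at most one place, since the second place \<open>t\<close> is not yet read.
  If the first place precedes \<open>k\<close>, then it and all later steps up to \<open>k\<close> lie in the epoch of \<open>t\<close>,
  where indices do not repeat; otherwise nothing has changed.\<close>

lemma swap_stability:
  assumes \<omega>: "\<omega> \<in> \<Omega>" and k: "1 \<le> k" "k \<le> t" "t \<le> T" and j: "j \<in> {1..n}"
  shows "vnorm (x (swap_entries (epoch n t) j (epoch_pos n t) \<omega>) k - x \<omega> k)
     \<le> 2 * \<eta> k * (sqrt (real n) * rms_lip n G)"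
proof -
  define q where "q = epoch n t"
  \<comment> \<open>the time at which entry \<open>j\<close> of that permutation is read; it may exceed \<open>T\<close>\<close>
  define s where "s = (q - 1) * n + j"
  define \<omega>' where "\<omega>' = swap_entries q j (epoch_pos n t) \<omega>"
  have t: "t \<ge> 1" using k by simp
  have tq: "t = (q - 1) * n + epoch_pos n t" and r: "epoch_pos n t \<in> {1..n}"
    using epoch_decomposition[OF n t] by (auto simp: q_def)
  have q: "q \<in> {1..epoch n T}"
    using epoch_mono[OF n t k(3)] epoch_eq[OF n t] by (auto simp: q_def)
  have \<omega>': "\<omega>' \<in> \<Omega>" unfolding \<omega>'_def by (rule swap_entries_in_rr[OF \<omega> j r q])
  have s1: "s \<ge> 1" using j by (simp add: s_def)
  have sq: "epoch n s = q" unfolding s_def using epoch_composition[OF n _ j] q by simp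
  have same: "idx \<omega>' i = idx \<omega> i" if "1 \<le> i" "i < k" "i \<noteq> s" for i
    unfolding \<omega>'_def
    by (rule rr_index_swap_other) (use n q that tq k in \<open>auto simp: s_def\<close>)
  have kT: "k \<in> {1..T}" using k by simp
  have nonneg: "0 \<le> 2 * \<eta> k * (sqrt (real n) * rms_lip n G)"
    using \<mu>_pos by (simp add: rms_lip_def sum_nonneg)
  have "vnorm (x \<omega>' k - x \<omega> k) \<le> 2 * \<eta> k * (sqrt (real n) * rms_lip n G)"
  proof (cases "s < k")
    case True
    have "epoch n i = q" if "i \<in> {s..<k}" for i
      using epoch_mono[OF n s1, of i] epoch_mono[OF n _, of i t] that s1 k sq q_def by force
    then have inj: "inj_on (idx \<omega>') {s..<k}" "inj_on (idx \<omega>) {s..<k}"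
      using rr_index_inj[OF _ n q] \<omega> \<omega>' s1 by (metis atLeastLessThan_iff le_trans)+
    show ?thesis
      using True by (intro run_stability[OF runs[OF \<omega>'] runs[OF \<omega>] idx_range[OF \<omega>'] idx_range[OF \<omega>]
            s1 _ kT same inj]) auto
  next
    case False
    have "x \<omega>' k = x \<omega> k"
      by (rule run_cong[OF runs[OF \<omega>'] runs[OF \<omega>] idx_range[OF \<omega>'] idx_range[OF \<omega>]])
         (use kT same False in auto)
    moreover have "x \<omega> k \<in> carrier_vec d" using x_edom[OF \<omega>, of k] kT edom_carrier by simp
    ultimately have "vnorm (x \<omega>' k - x \<omega> k) = 0"
      by (simp add: vnorm_def scalar_prod_minus_distrib[of _ d])
    then show ?thesis using nonneg by simp
  qed
  then show ?thesis by (simp add: \<omega>'_def q_def)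
qed

text \<open>This is needed not only for \<open>k = t\<close>, where the gradient is taken, but for all earlier
  iterates too, because they enter the reference points of the last-iterate argument. For \<open>k\<close> in
  an earlier epoch the bias is in fact zero, but the bound below already has the right order.\<close>

lemma sampling_bias:
  assumes k: "1 \<le> k" "k \<le> t" "t \<le> T"
  shows "\<bar>E (\<lambda>\<omega>. fbar (x \<omega> k)) - E (\<lambda>\<omega>. f (idx \<omega> t) (x \<omega> k))\<bar> \<le> 2 * \<eta> k * noise"
proof -
  let ?S = "\<lambda>j. swap_entries (epoch n t) j (epoch_pos n t)"
  let ?B = "2 * \<eta> k * (sqrt (real n) * rms_lip n G)"
  have t: "t \<in> {1..T}" "t \<ge> 1" using k by auto
  have r: "epoch_pos n t \<in> {1..n}" using epoch_decomposition(2)[OF n t(2)] .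
  have q: "epoch n t \<in> {1..epoch n T}"
    using epoch_mono[OF n t(2) k(3)] epoch_eq[OF n t(2)] by auto
  have swap: "\<bar>E (\<lambda>\<omega>. f (idx \<omega> t) (x (?S j \<omega>) k)) - E (\<lambda>\<omega>. f (idx \<omega> t) (x \<omega> k))\<bar> \<le> mean_lip n G * ?B"
    if j: "j \<in> {1..n}" for j
  proof -
    have "\<bar>E (\<lambda>\<omega>. f (idx \<omega> t) (x (?S j \<omega>) k)) - E (\<lambda>\<omega>. f (idx \<omega> t) (x \<omega> k))\<bar>
        = \<bar>E (\<lambda>\<omega>. f (idx \<omega> t) (x (?S j \<omega>) k) - f (idx \<omega> t) (x \<omega> k))\<bar>" by simp
    also have "\<dots> \<le> E (\<lambda>\<omega>. \<bar>f (idx \<omega> t) (x (?S j \<omega>) k) - f (idx \<omega> t) (x \<omega> k)\<bar>)"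
      by (rule integral_abs_bound)
    also have "\<dots> \<le> E (\<lambda>\<omega>. G (idx \<omega> t) * ?B)"
    proof (rule E_mono)
      fix \<omega> assume \<omega>: "\<omega> \<in> \<Omega>"
      have i: "idx \<omega> t \<in> {1..n}" using idx_range[OF \<omega> t(1)] .
      have "\<bar>f (idx \<omega> t) (x (?S j \<omega>) k) - f (idx \<omega> t) (x \<omega> k)\<bar>
          \<le> G (idx \<omega> t) * vnorm (x (?S j \<omega>) k - x \<omega> k)"
        using k by (intro f_lipschitz i x_edom \<omega> swap_entries_in_rr[OF \<omega> j r q]) auto
      also have "\<dots> \<le> G (idx \<omega> t) * ?B"
        using G_pos[OF i] swap_stability[OF \<omega> k j] by (intro mult_left_mono) auto
      finally show "\<bar>f (idx \<omega> t) (x (?S j \<omega>) k) - f (idx \<omega> t) (x \<omega> k)\<bar> \<le> G (idx \<omega> t) * ?B" .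
    qed
    also have "\<dots> = mean_lip n G * ?B"
      using E_uniform_index[OF t(1), of G] by (simp add: mean_lip_def)
    finally show ?thesis .
  qed
  have "E (\<lambda>\<omega>. fbar (x \<omega> k)) = (\<Sum>j=1..n. E (\<lambda>\<omega>. f (idx \<omega> t) (x (?S j \<omega>) k))) / real n"
    unfolding fbar_def by (rule rr_exchange[OF n t(1)])
  then have "E (\<lambda>\<omega>. fbar (x \<omega> k)) - E (\<lambda>\<omega>. f (idx \<omega> t) (x \<omega> k))
      = (\<Sum>j=1..n. E (\<lambda>\<omega>. f (idx \<omega> t) (x (?S j \<omega>) k)) - E (\<lambda>\<omega>. f (idx \<omega> t) (x \<omega> k))) / real n"
    using n by (simp add: sum_subtractf diff_divide_distrib)
  moreover have "\<bar>(\<Sum>j=1..n. c j) / real n\<bar> \<le> b" if "\<And>j. j \<in> {1..n} \<Longrightarrow> \<bar>c j\<bar> \<le> b" for c :: "nat \<Rightarrow> real" and b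
  proof -
    have "\<bar>\<Sum>j=1..n. c j\<bar> \<le> (\<Sum>j=1..n. b)"
      by (rule order_trans[OF sum_abs sum_mono[OF that]])
    then show ?thesis using n by (simp add: field_simps)
  qed
  ultimately have "\<bar>E (\<lambda>\<omega>. fbar (x \<omega> k)) - E (\<lambda>\<omega>. f (idx \<omega> t) (x \<omega> k))\<bar> \<le> mean_lip n G * ?B"
    using swap by simp
  also have "\<dots> = 2 * \<eta> k * noise" by (simp add: noise_def)
  finally show ?thesis .
qed

text \<open>The squared gradient norms of the usual analysis are absorbed by the bias, because
  \<open>rms_lip n G \<le> \<surd>n * mean_lip n G\<close>.\<close>

lemma lip_noise:
  shows "(rms_lip n G)\<^sup>2 \<le> noise" and "(mean_lip n G)\<^sup>2 \<le> noise" and "0 \<le> noise"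
proof -
  have s: "0 \<le> (\<Sum>i=1..n. G i)" "0 \<le> (\<Sum>i=1..n. (G i)\<^sup>2)"
    by (intro sum_nonneg less_imp_le[OF G_pos] zero_le_power2; simp)+
  have nn: "0 \<le> mean_lip n G" "0 \<le> rms_lip n G"
    using s by (auto simp: mean_lip_def rms_lip_def)
  then show "0 \<le> noise" by (simp add: noise_def)
  have "(\<Sum>i=1..n. (G i)\<^sup>2) \<le> (\<Sum>i=1..n. G i * (\<Sum>i=1..n. G i))"
    unfolding power2_eq_square
    by (intro sum_mono mult_left_mono member_le_sum less_imp_le[OF G_pos]) auto
  then have "(\<Sum>i=1..n. (G i)\<^sup>2) \<le> (\<Sum>i=1..n. G i)\<^sup>2"
    by (simp add: power2_eq_square sum_distrib_right)
  then have "(rms_lip n G)\<^sup>2 \<le> (sqrt (real n) * mean_lip n G)\<^sup>2"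
    using n s by (simp add: rms_lip_def mean_lip_def power_mult_distrib power_divide
        power2_eq_square[of "real n"] divide_right_mono)
  then have le: "rms_lip n G \<le> sqrt (real n) * mean_lip n G"
    by (rule power2_le_imp_le) (use nn in simp)
  show "(rms_lip n G)\<^sup>2 \<le> noise"
    using mult_right_mono[OF le nn(2)] by (simp add: noise_def power2_eq_square)
  have "(\<Sum>i=1..n. G i)\<^sup>2 \<le> real n * (\<Sum>i=1..n. (G i)\<^sup>2)"
    using sum_squared_le_sum_of_squares[of G "{1..n}"] by (simp add: mult.commute)
  then have "(\<Sum>i=1..n. G i)\<^sup>2 / (real n)\<^sup>2 \<le> real n * (\<Sum>i=1..n. (G i)\<^sup>2) / (real n)\<^sup>2"
    by (intro divide_right_mono) auto
  then have "(mean_lip n G)\<^sup>2 \<le> (rms_lip n G)\<^sup>2"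
    using n s by (simp add: rms_lip_def mean_lip_def power_divide power2_eq_square[of "real n"])
  then show "(mean_lip n G)\<^sup>2 \<le> noise"
    using \<open>(rms_lip n G)\<^sup>2 \<le> noise\<close> by linarith
qed

end


section \<open>The averaging weights\<close>

text \<open>\<open>weight m j\<close> belongs to step \<open>j + 1\<close>; the recurrence
  \<open>weight_Suc\<close> is exactly what makes the squared distances telescope, since one step turns the
  coefficient \<open>t\<close> into \<open>t + m\<close>. The share \<open>mix m T s\<close> of a weight in the tail that starts with it
  is 1 at the last step, so that an average formed with these shares ends at the last iterate.\<close>

definition weight :: "nat \<Rightarrow> nat \<Rightarrow> real" where
  "weight m j = real ((j + m) choose Suc j)"

definition mix :: "nat \<Rightarrow> nat \<Rightarrow> nat \<Rightarrow> real" where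
  "mix m T s = weight m s / (\<Sum>j=s..<T. weight m j)"

lemma weight_pos: "m \<ge> 1 \<Longrightarrow> weight m j > 0"
  by (simp add: weight_def)

lemma weight_Suc: "weight m (Suc j) * real (j + 2) = weight m j * real (Suc j + m)"
proof -
  have "(Suc j + m choose Suc (Suc j)) * (j + 2) = (j + m choose Suc j) * (Suc j + m)"
    using Suc_times_binomial_eq[of "j + m" "Suc j"] by (simp add: mult.commute)
  then show ?thesis
    unfolding weight_def by (simp only: of_nat_mult[symmetric])
qed

lemma weight_mono:
  assumes "m \<ge> 1"
  shows "mono (weight m)"
proof (rule monoI)
  have step: "weight m j \<le> weight m (Suc j)" for j
  proof -
    have "weight m j * real (j + 2) \<le> weight m j * real (Suc j + m)"
      using assms weight_pos[OF assms, of j] by (intro mult_left_mono) auto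
    then show ?thesis unfolding weight_Suc[symmetric] by simp
  qed
  show "weight m i \<le> weight m j" if "i \<le> j" for i j
    using that by (rule lift_Suc_mono_le[of "weight m", OF step])
qed

lemma weight_sum_ge:
  assumes "m \<ge> 1" "T \<ge> 1"
  shows "real ((m + T) choose m) \<le> 2 * (\<Sum>j=0..<T. weight m j)"
proof -
  have "(\<Sum>j=0..<T. weight m j) + 1 = real ((T + m) choose T)"
  proof (induction T)
    case (Suc k)
    then show ?case by (simp add: weight_def)
  qed simp
  moreover have "(T + m) choose T = (m + T) choose m"
    by (metis add.commute binomial_symmetric diff_add_inverse le_add1)
  moreover have "1 \<le> (\<Sum>j=0..<T. weight m j)"
  proof -
    have "weight m 0 \<le> (\<Sum>j=0..<T. weight m j)"
      using assms by (intro member_le_sum less_imp_le[OF weight_pos]) auto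
    then show ?thesis using assms by (simp add: weight_def)
  qed
  ultimately show ?thesis by simp
qed

lemma tail_sum_pos: "m \<ge> 1 \<Longrightarrow> s < T \<Longrightarrow> (\<Sum>j=s..<T. weight m j) > 0"
  by (intro sum_pos) (auto simp: weight_pos)

lemma mix_pos: "m \<ge> 1 \<Longrightarrow> s < T \<Longrightarrow> mix m T s > 0"
  by (simp add: mix_def weight_pos tail_sum_pos)

lemma mix_last: "m \<ge> 1 \<Longrightarrow> mix m (Suc s) s = 1"
  using weight_pos[of m s] by (simp add: mix_def)

lemma mix_complement:
  assumes "m \<ge> 1" "Suc s < T"
  shows "1 - mix m T s = (\<Sum>j=Suc s..<T. weight m j) / (\<Sum>j=s..<T. weight m j)"
proof -
  have "(\<Sum>j=s..<T. weight m j) = weight m s + (\<Sum>j=Suc s..<T. weight m j)"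
    using assms by (intro sum.atLeast_Suc_lessThan) auto
  then show ?thesis
    using tail_sum_pos[of m s T] assms by (simp add: mix_def field_simps)
qed

lemma mix_less_1: "m \<ge> 1 \<Longrightarrow> Suc s < T \<Longrightarrow> mix m T s < 1"
  using divide_pos_pos[OF tail_sum_pos[of m "Suc s" T] tail_sum_pos[of m s T]]
  by (simp flip: mix_complement)

lemma mix_recurrence:
  assumes "m \<ge> 1" "Suc s < T"
  shows "mix m T (Suc s) * real (s + 2) * (1 - mix m T s) = mix m T s * real (Suc s + m)"
proof -
  have *: "mix m T (Suc s) * (1 - mix m T s) = weight m (Suc s) / (\<Sum>j=s..<T. weight m j)"
    using tail_sum_pos[of m "Suc s" T] assms
    unfolding mix_complement[OF assms] by (simp add: mix_def)
  have "mix m T (Suc s) * real (s + 2) * (1 - mix m T s)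
      = mix m T (Suc s) * (1 - mix m T s) * real (s + 2)"
    by (simp only: mult_ac)
  also have "\<dots> = weight m (Suc s) * real (s + 2) / (\<Sum>j=s..<T. weight m j)"
    unfolding * by (rule times_divide_eq_left)
  finally show ?thesis unfolding weight_Suc by (simp add: mix_def)
qed

text \<open>The weights increase, so the first one of a tail is at most the mean of the tail.\<close>

lemma mix_le:
  assumes "m \<ge> 1" "s < T"
  shows "mix m T s \<le> 1 / real (T - s)"
proof -
  have "real (card {s..<T}) * weight m s \<le> (\<Sum>j=s..<T. weight m j)"
    using monoD[OF weight_mono[OF assms(1)]] by (intro sum_bounded_below) auto
  then show ?thesis
    using assms tail_sum_pos[OF assms] by (simp add: mix_def field_simps)
qed

lemma harm_le_ln: "T \<ge> 1 \<Longrightarrow> harm T \<le> 1 + ln (real T)"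
  using decseqD[OF decseq_harm_diff_ln, of 0 "T - 1"] by (simp add: harm_Suc harm_expand)

text \<open>Partial fractions turn the sum into two harmonic sums.\<close>

lemma mix_step_sum:
  assumes "m \<ge> 1" "T \<ge> 1"
  shows "(\<Sum>s<T. mix m T s / real (Suc s)) \<le> 2 * (1 + ln (real T)) / real T"
proof -
  have h: "(\<Sum>s<T. 1 / real (Suc s)) = harm T"
    unfolding harm_def by (simp add: inverse_eq_divide sum.atLeast1_atMost_eq)
  have "(\<Sum>s<T. 1 / real (T - s)) = (\<Sum>s<T. 1 / real (Suc (T - Suc s)))"
    by (intro sum.cong) (auto simp: Suc_diff_Suc)
  then have h': "(\<Sum>s<T. 1 / real (T - s)) = harm T"
    using sum.nat_diff_reindex[of "\<lambda>s. 1 / real (Suc s)" T] h by simp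
  have "(\<Sum>s<T. mix m T s / real (Suc s))
      \<le> (\<Sum>s<T. (1 / real (Suc s) + 1 / real (T - s)) / (real T + 1))"
  proof (rule sum_mono)
    fix s assume "s \<in> {..<T}"
    then have s: "s < T" by simp
    have "mix m T s / real (Suc s) \<le> 1 / real (T - s) / real (Suc s)"
      by (intro divide_right_mono mix_le assms s) simp
    also have "\<dots> = (1 / real (Suc s) + 1 / real (T - s)) / (real T + 1)"
    proof -
      define a b where "a = real (Suc s)" and "b = real (T - s)"
      have "a > 0" "b > 0" "real T + 1 = a + b" using s by (auto simp: a_def b_def)
      then show ?thesis unfolding a_def[symmetric] b_def[symmetric]
        by (simp add: add_frac_eq add.commute)
    qed
    finally show "mix m T s / real (Suc s) \<le> (1 / real (Suc s) + 1 / real (T - s)) / (real T + 1)" .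
  qed
  also have "\<dots> = 2 * harm T / (real T + 1)"
    unfolding sum_divide_distrib[symmetric] sum.distrib h h' by simp
  also have "\<dots> \<le> 2 * (1 + ln (real T)) / real T"
    using assms harm_le_ln[OF assms(2)] by (intro frac_le) auto
  finally show ?thesis .
qed


section \<open>Convergence of the last iterate\<close>

context random_reshuffling
begin

abbreviation \<theta> :: "nat \<Rightarrow> real" where "\<theta> \<equiv> mix m T"

definition objective :: "real vec \<Rightarrow> real" where "objective y = \<psi>r y + fbar y"

text \<open>Reference points in the manner of Zamani and Glineur: step \<open>s + 1\<close> is compared with a convex
  combination of \<open>z\<close> and the iterates produced so far. The number \<open>ref_value z s\<close> runs the same
  recursion on the values, with the bound on the sampling bias of each iterate added. Since the last share is 1,
  \<open>ref_value z T\<close> is the expected value at the last iterate plus such a bound.\<close>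

primrec ref_point :: "real vec \<Rightarrow> (nat \<Rightarrow> nat \<Rightarrow> nat) \<Rightarrow> nat \<Rightarrow> real vec" where
  "ref_point z \<omega> 0 = z"
| "ref_point z \<omega> (Suc s) = (1 - \<theta> s) \<cdot>\<^sub>v ref_point z \<omega> s + \<theta> s \<cdot>\<^sub>v x \<omega> (s + 2)"

primrec ref_value :: "real vec \<Rightarrow> nat \<Rightarrow> real" where
  "ref_value z 0 = objective z"
| "ref_value z (Suc s) = (1 - \<theta> s) * ref_value z s
     + \<theta> s * (E (\<lambda>\<omega>. objective (x \<omega> (s + 2))) + 2 * \<eta> (s + 2) * noise)"

lemma ref_point_edom:
  assumes \<omega>: "\<omega> \<in> \<Omega>" and z: "z \<in> edom d \<psi>" and s: "s < T"
  shows "ref_point z \<omega> s \<in> edom d \<psi>"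
  using s
proof (induction s)
  case (Suc s)
  then show ?case
    using mix_pos[OF m, of s T] mix_less_1[OF m, of s T] x_edom[OF \<omega>, of "s + 2"]
    by (auto intro!: edom_convex(1))
qed (simp add: z)

lemma f_convex:
  assumes i: "i \<in> {1..n}" and u: "0 < u" "u < 1" and y: "y \<in> carrier_vec d" and w: "w \<in> carrier_vec d"
  shows "f i ((1 - u) \<cdot>\<^sub>v y + u \<cdot>\<^sub>v w) \<le> (1 - u) * f i y + u * f i w"
proof -
  have "ereal (f i ((1 - u) \<cdot>\<^sub>v y + u \<cdot>\<^sub>v w)) \<le> ereal (1 - u) * ereal (f i y) + ereal u * ereal (f i w)"
    using f_conv[OF i] u y w unfolding convex_fun_def by blast
  then show ?thesis by simp
qed

text \<open>The sampled component at time \<open>t\<close> is correlated with the reference point when both belong to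
  one epoch. Convexity breaks the reference point into single iterates, for each of which the bias
  is known; the resulting bound does not depend on \<open>t\<close>.\<close>

lemma E_ref_value:
  assumes z: "z \<in> edom d \<psi>" and s: "s < t" "t \<le> T"
  shows "E (\<lambda>\<omega>. \<psi>r (ref_point z \<omega> s) + f (idx \<omega> t) (ref_point z \<omega> s)) \<le> ref_value z s"
  using s
proof (induction s)
  case 0
  have "E (\<lambda>\<omega>. f (idx \<omega> t) z) = fbar z"
    using 0 E_uniform_index[of t "\<lambda>i. f i z"] by (simp add: fbar_def)
  then show ?case by (simp add: objective_def)
next
  case (Suc s)
  let ?h = "\<lambda>\<omega> y. \<psi>r y + f (idx \<omega> t) y"
  have t: "t \<in> {1..T}" and sT: "Suc s < T" using Suc.prems by auto
  note \<theta> = mix_pos[OF m Suc_lessD[OF sT]] mix_less_1[OF m sT]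
  have "E (\<lambda>\<omega>. ?h \<omega> (ref_point z \<omega> (Suc s)))
      \<le> E (\<lambda>\<omega>. (1 - \<theta> s) * ?h \<omega> (ref_point z \<omega> s) + \<theta> s * ?h \<omega> (x \<omega> (s + 2)))"
  proof (rule E_mono)
    fix \<omega> assume \<omega>: "\<omega> \<in> \<Omega>"
    have dom: "ref_point z \<omega> s \<in> edom d \<psi>" "x \<omega> (s + 2) \<in> edom d \<psi>"
      using ref_point_edom[OF \<omega> z, of s] x_edom[OF \<omega>, of "s + 2"] sT by auto
    show "?h \<omega> (ref_point z \<omega> (Suc s))
        \<le> (1 - \<theta> s) * ?h \<omega> (ref_point z \<omega> s) + \<theta> s * ?h \<omega> (x \<omega> (s + 2))"
      using edom_convex(2)[OF dom \<theta>] f_convex[OF idx_range[OF \<omega> t] \<theta> dom[THEN edom_carrier]]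
      by (simp add: algebra_simps)
  qed
  also have "\<dots> = (1 - \<theta> s) * E (\<lambda>\<omega>. ?h \<omega> (ref_point z \<omega> s)) + \<theta> s * E (\<lambda>\<omega>. ?h \<omega> (x \<omega> (s + 2)))"
    by simp
  also have "\<dots> \<le> ref_value z (Suc s)"
  proof -
    have "E (\<lambda>\<omega>. ?h \<omega> (x \<omega> (s + 2))) \<le> E (\<lambda>\<omega>. objective (x \<omega> (s + 2))) + 2 * \<eta> (s + 2) * noise"
      using sampling_bias[of "s + 2" t] Suc.prems unfolding objective_def by simp
    then show ?thesis
      unfolding ref_value.simps using \<theta> Suc
      by (intro add_mono mult_left_mono Suc.IH) auto
  qed
  finally show ?case .
qed

lemma fbar_lipschitz:
  assumes "y \<in> edom d \<psi>" "w \<in> edom d \<psi>"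
  shows "\<bar>fbar y - fbar w\<bar> \<le> mean_lip n G * vnorm (y - w)"
proof -
  have "\<bar>fbar y - fbar w\<bar> = \<bar>\<Sum>i=1..n. f i y - f i w\<bar> / real n"
    by (simp add: fbar_def sum_subtractf diff_divide_distrib[symmetric])
  also have "\<dots> \<le> (\<Sum>i=1..n. G i * vnorm (y - w)) / real n"
    by (intro divide_right_mono order_trans[OF sum_abs] sum_mono f_lipschitz assms) auto
  also have "\<dots> = mean_lip n G * vnorm (y - w)"
    by (simp add: mean_lip_def sum_distrib_right)
  finally show ?thesis .
qed

text \<open>The displacement \<open>\<parallel>x (t + 1) - x t\<parallel>\<close> is paid twice: for the linearisation of the sampled
  component at \<open>x t\<close>, and for moving the argument of the average from \<open>x t\<close> to \<open>x (t + 1)\<close>. The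
  proximal term absorbs both at the cost of squared Lipschitz constants.\<close>

lemma one_step:
  assumes \<omega>: "\<omega> \<in> \<Omega>" and t: "t \<in> {1..T}" and w: "w \<in> edom d \<psi>"
  defines "\<kappa> \<equiv> \<mu> / (2 * real m)"
  shows "objective (x \<omega> (Suc t)) + \<kappa> * real (t + m) * (vnorm (w - x \<omega> (Suc t)))\<^sup>2
      \<le> fbar (x \<omega> t) - f (idx \<omega> t) (x \<omega> t) + (\<psi>r w + f (idx \<omega> t) w)
         + \<kappa> * real t * (vnorm (w - x \<omega> t))\<^sup>2
         + \<eta> t * ((G (idx \<omega> t))\<^sup>2 + (mean_lip n G)\<^sup>2)"
proof -
  let ?i = "idx \<omega> t" and ?p = "x \<omega> (Suc t)" and ?c = "x \<omega> t"
  let ?v = "g ?i ?c" and ?D = "vnorm (?p - ?c)"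
  have i: "?i \<in> {1..n}" using idx_range[OF \<omega> t] .
  have dom: "?c \<in> edom d \<psi>" "?p \<in> edom d \<psi>" using x_edom[OF \<omega>] t by auto
  note car = dom[THEN edom_carrier] edom_carrier[OF w]
  have v: "?v \<in> carrier_vec d" using g_carrier[OF i car(1)] .
  have \<eta>: "\<eta> t > 0" using \<eta>_pos t by simp
  have \<kappa>: "1 / (2 * \<eta> t) = \<kappa> * real t"
    using t m \<mu>_pos by (simp add: \<kappa>_def field_simps)
  have \<kappa>': "\<kappa> * real (t + m) = \<kappa> * real t + \<mu> / 2"
    using m by (simp add: \<kappa>_def field_simps)
  have "\<psi>r ?p + scalar_prod ?v (?p - w)
           + (?D\<^sup>2 + (vnorm (w - ?p))\<^sup>2 - (vnorm (w - ?c))\<^sup>2) * (1 / (2 * \<eta> t))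
           + \<mu> / 2 * (vnorm (w - ?p))\<^sup>2 \<le> \<psi>r w"
    using prox_three_point[OF run_step[OF runs[OF \<omega>] t] dom(1) v \<eta> w] by simp
  then have 1: "\<psi>r ?p + scalar_prod ?v (?p - w) + \<kappa> * real t * ?D\<^sup>2
           + \<kappa> * real (t + m) * (vnorm (w - ?p))\<^sup>2 \<le> \<psi>r w + \<kappa> * real t * (vnorm (w - ?c))\<^sup>2"
    unfolding \<kappa> \<kappa>' by (simp add: algebra_simps)
  have "scalar_prod ?v (?p - w) = scalar_prod ?v (?p - ?c) - scalar_prod ?v (w - ?c)"
    using v car by (simp add: scalar_prod_minus_distrib[of _ d])
  moreover have "- scalar_prod ?v (?p - ?c) \<le> G ?i * ?D"
  proof -
    have "- scalar_prod ?v (?p - ?c) \<le> vnorm ?v * ?D"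
      using abs_scalar_prod_le[OF v, of "?p - ?c"] car by simp
    also have "\<dots> \<le> G ?i * ?D" using g_norm[OF i dom(1)] by (intro mult_right_mono) auto
    finally show ?thesis .
  qed
  moreover have "f ?i ?c + scalar_prod ?v (w - ?c) \<le> f ?i w"
    by (rule g_subgradient[OF i car(1,3)])
  ultimately have 2: "f ?i ?c - f ?i w - G ?i * ?D \<le> scalar_prod ?v (?p - w)" by linarith
  have 3: "fbar ?p \<le> fbar ?c + mean_lip n G * ?D"
    using fbar_lipschitz[OF dom(2,1)] by linarith
  have 4: "(G ?i + mean_lip n G) * ?D \<le> \<kappa> * real t * ?D\<^sup>2 + \<eta> t * ((G ?i)\<^sup>2 + (mean_lip n G)\<^sup>2)"
  proof -
    have \<kappa>t: "\<kappa> * real t * (2 * \<eta> t) = 1" using t m \<mu>_pos by (simp add: \<kappa>_def)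
    let ?a = "G ?i" and ?b = "mean_lip n G"
    \<comment> \<open>Young's inequality for \<open>?D\<close> against \<open>?a + ?b\<close>, and \<open>(?a + ?b)\<^sup>2 + (?a - ?b)\<^sup>2 = 2 * (?a\<^sup>2 + ?b\<^sup>2)\<close>\<close>
    have "0 \<le> \<kappa> * real t * ((?D - \<eta> t * (?a + ?b))\<^sup>2 + (\<eta> t)\<^sup>2 * (?a - ?b)\<^sup>2)"
      using m \<mu>_pos by (intro mult_nonneg_nonneg) (auto simp: \<kappa>_def)
    also have "\<dots> = \<kappa> * real t * ?D\<^sup>2 - (\<kappa> * real t * (2 * \<eta> t)) * ((?a + ?b) * ?D)
        + (\<kappa> * real t * (2 * \<eta> t)) * \<eta> t * (?a\<^sup>2 + ?b\<^sup>2)"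
    proof -
      have "k * ((D - h * (a + b))\<^sup>2 + h\<^sup>2 * (a - b)\<^sup>2)
          = k * D\<^sup>2 - (k * (2 * h)) * ((a + b) * D) + (k * (2 * h)) * h * (a\<^sup>2 + b\<^sup>2)"
        for k D h a b :: real
        by (simp add: power2_eq_square algebra_simps)
      then show ?thesis .
    qed
    also have "\<dots> = \<kappa> * real t * ?D\<^sup>2 - (?a + ?b) * ?D + \<eta> t * (?a\<^sup>2 + ?b\<^sup>2)"
      unfolding \<kappa>t by simp
    finally show ?thesis by linarith
  qed
  show ?thesis
    unfolding objective_def using 1 2 3 4 by (simp only: distrib_right)
qed

lemma expected_step:
  assumes z: "z \<in> edom d \<psi>" and s: "s < T"
  defines "\<kappa> \<equiv> \<mu> / (2 * real m)"
  shows "E (\<lambda>\<omega>. objective (x \<omega> (s + 2))) + \<kappa> * real (Suc s + m) * E (\<lambda>\<omega>. (vnorm (ref_point z \<omega> s - x \<omega> (s + 2)))\<^sup>2)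
      \<le> ref_value z s + \<kappa> * real (Suc s) * E (\<lambda>\<omega>. (vnorm (ref_point z \<omega> s - x \<omega> (Suc s)))\<^sup>2)
         + 4 * \<eta> (Suc s) * noise"
proof -
  have t: "Suc s \<in> {1..T}" using s by simp
  have \<eta>: "0 \<le> \<eta> (Suc s)" using \<eta>_pos[of "Suc s"] by simp
  have "0 \<le> \<kappa>" using \<mu>_pos by (simp add: \<kappa>_def)
  let ?w = "\<lambda>\<omega>. ref_point z \<omega> s" and ?i = "\<lambda>\<omega>. idx \<omega> (Suc s)" and ?c = "\<lambda>\<omega>. x \<omega> (Suc s)"
  have "E (\<lambda>\<omega>. objective (x \<omega> (s + 2)) + \<kappa> * real (Suc s + m) * (vnorm (?w \<omega> - x \<omega> (s + 2)))\<^sup>2)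
      \<le> E (\<lambda>\<omega>. fbar (?c \<omega>) - f (?i \<omega>) (?c \<omega>) + (\<psi>r (?w \<omega>) + f (?i \<omega>) (?w \<omega>))
         + \<kappa> * real (Suc s) * (vnorm (?w \<omega> - ?c \<omega>))\<^sup>2
         + \<eta> (Suc s) * ((G (?i \<omega>))\<^sup>2 + (mean_lip n G)\<^sup>2))"
    using one_step[OF _ t ref_point_edom[OF _ z s]] unfolding \<kappa>_def by (intro E_mono) simp
  moreover have "E (\<lambda>\<omega>. (G (?i \<omega>))\<^sup>2) = (rms_lip n G)\<^sup>2"
    using E_uniform_index[OF t, of "\<lambda>i. (G i)\<^sup>2"] n by (simp add: rms_lip_def sum_nonneg)
  ultimately have "E (\<lambda>\<omega>. objective (x \<omega> (s + 2)))
        + \<kappa> * real (Suc s + m) * E (\<lambda>\<omega>. (vnorm (?w \<omega> - x \<omega> (s + 2)))\<^sup>2)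
      \<le> (E (\<lambda>\<omega>. fbar (?c \<omega>)) - E (\<lambda>\<omega>. f (?i \<omega>) (?c \<omega>)))
         + E (\<lambda>\<omega>. \<psi>r (?w \<omega>) + f (?i \<omega>) (?w \<omega>))
         + \<kappa> * real (Suc s) * E (\<lambda>\<omega>. (vnorm (?w \<omega> - ?c \<omega>))\<^sup>2)
         + \<eta> (Suc s) * ((rms_lip n G)\<^sup>2 + (mean_lip n G)\<^sup>2)"
    by simp
  also have "\<dots> \<le> 2 * \<eta> (Suc s) * noise + ref_value z s
         + \<kappa> * real (Suc s) * E (\<lambda>\<omega>. (vnorm (?w \<omega> - ?c \<omega>))\<^sup>2)
         + \<eta> (Suc s) * (noise + noise)"
    using sampling_bias[of "Suc s" "Suc s"] E_ref_value[OF z, of s "Suc s"] s \<eta> \<open>0 \<le> \<kappa>\<close>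
    by (intro add_mono mult_left_mono lip_noise) auto
  finally show ?thesis by (simp add: algebra_simps)
qed

text \<open>Weighted by \<open>\<theta> s\<close>, the excess of the new iterate, with its bias bound, over the reference value is the
  increment of \<open>ref_value\<close>, so both the values and, by \<open>mix_recurrence\<close>, the distances telescope.\<close>

lemma ref_value_bound:
  assumes z: "z \<in> edom d \<psi>" and s: "s < T"
  defines "\<kappa> \<equiv> \<mu> / (2 * real m)"
  shows "ref_value z s + \<theta> s * \<kappa> * real (Suc s) * E (\<lambda>\<omega>. (vnorm (ref_point z \<omega> s - x \<omega> (Suc s)))\<^sup>2)
     \<le> objective z + \<theta> 0 * \<kappa> * (vnorm (z - x1))\<^sup>2 + 6 * (real m / \<mu>) * noise * (\<Sum>j<s. \<theta> j / real (Suc j))"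
    (is "?A s \<le> ?B s")
    and "ref_value z (Suc s)
     \<le> objective z + \<theta> 0 * \<kappa> * (vnorm (z - x1))\<^sup>2 + 6 * (real m / \<mu>) * noise * (\<Sum>j<Suc s. \<theta> j / real (Suc j))"
proof -
  let ?R = "\<lambda>s. E (\<lambda>\<omega>. (vnorm (ref_point z \<omega> s - x \<omega> (Suc s)))\<^sup>2)"
  let ?R' = "\<lambda>s. E (\<lambda>\<omega>. (vnorm (ref_point z \<omega> s - x \<omega> (s + 2)))\<^sup>2)"
  have \<kappa>: "\<kappa> > 0" using \<mu>_pos m by (simp add: \<kappa>_def)
  have step: "ref_value z (Suc s) + \<theta> s * \<kappa> * real (Suc s + m) * ?R' s
      \<le> ?A s + 6 * (real m / \<mu>) * noise * (\<theta> s / real (Suc s))" if s: "s < T" for s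
  proof -
    have \<theta>: "\<theta> s > 0" using mix_pos[OF m s] .
    have \<eta>: "\<eta> (s + 2) \<le> \<eta> (Suc s)"
      using \<mu>_pos m by (intro divide_left_mono) auto
    have "E (\<lambda>\<omega>. objective (x \<omega> (s + 2))) + 2 * \<eta> (s + 2) * noise + \<kappa> * real (Suc s + m) * ?R' s
        \<le> ref_value z s + \<kappa> * real (Suc s) * ?R s + 6 * \<eta> (Suc s) * noise"
    proof -
      have lin: "\<lbrakk>A + P \<le> B + 4 * a; b \<le> a\<rbrakk> \<Longrightarrow> A + 2 * b + P \<le> B + 6 * a" for A P B a b :: real
        by linarith
      show ?thesis
        using expected_step[OF z s] mult_right_mono[OF \<eta> lip_noise(3)]
        unfolding \<kappa>_def mult.assoc by (rule lin)
    qed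
    then have "\<theta> s * (E (\<lambda>\<omega>. objective (x \<omega> (s + 2))) + 2 * \<eta> (s + 2) * noise + \<kappa> * real (Suc s + m) * ?R' s)
        \<le> \<theta> s * (ref_value z s + \<kappa> * real (Suc s) * ?R s + 6 * \<eta> (Suc s) * noise)"
      using \<theta> by (intro mult_left_mono) auto
    moreover have "\<theta> s * (6 * \<eta> (Suc s) * noise) = 6 * (real m / \<mu>) * noise * (\<theta> s / real (Suc s))"
      by simp
    ultimately show ?thesis
      unfolding ref_value.simps
      by (simp only: distrib_left left_diff_distrib mult.assoc mult_1)
  qed
  have bound: "?A s \<le> ?B s" if "s < T" for s
    using that
  proof (induction s)
    case 0
    have "E (\<lambda>\<omega>. (vnorm (z - x \<omega> (Suc 0)))\<^sup>2) = E (\<lambda>\<omega>. (vnorm (z - x1))\<^sup>2)"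
      by (intro integral_cong_AE)
         (auto intro!: AE_pmfI dest!: runs simp: prox_gradient_iterates_def)
    then show ?case by simp
  next
    case (Suc s)
    note \<theta> = mix_pos[OF m Suc_lessD[OF Suc.prems]] mix_less_1[OF m Suc.prems]
      mix_pos[OF m Suc.prems]
    \<comment> \<open>moving the reference point towards the new iterate shrinks their distance\<close>
    have "?R (Suc s) \<le> (1 - \<theta> s) * ?R' s"
    proof -
      have "?R (Suc s) \<le> E (\<lambda>\<omega>. (1 - \<theta> s) * (vnorm (ref_point z \<omega> s - x \<omega> (s + 2)))\<^sup>2)"
      proof (rule E_mono)
        fix \<omega> assume \<omega>: "\<omega> \<in> \<Omega>"
        have car: "ref_point z \<omega> s \<in> carrier_vec d" "x \<omega> (s + 2) \<in> carrier_vec d"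
          using ref_point_edom[OF \<omega> z, of s] x_edom[OF \<omega>, of "s + 2"] Suc.prems edom_carrier by auto
        have "(1 - \<theta> s)\<^sup>2 \<le> 1 - \<theta> s"
          using \<theta> power_decreasing[of 1 2 "1 - \<theta> s"] by simp
        then show "(vnorm (ref_point z \<omega> (Suc s) - x \<omega> (Suc (Suc s))))\<^sup>2
            \<le> (1 - \<theta> s) * (vnorm (ref_point z \<omega> s - x \<omega> (s + 2)))\<^sup>2"
          using vnorm_convex_combination_sq[OF car, of "\<theta> s"] by (simp add: mult_right_mono)
      qed
      then show ?thesis by simp
    qed
    then have "\<theta> (Suc s) * \<kappa> * real (Suc (Suc s)) * ?R (Suc s)
        \<le> \<theta> (Suc s) * \<kappa> * real (Suc (Suc s)) * ((1 - \<theta> s) * ?R' s)"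
      using \<theta> \<kappa> by (intro mult_left_mono) auto
    also have "\<dots> = \<kappa> * (\<theta> (Suc s) * real (s + 2) * (1 - \<theta> s)) * ?R' s"
      by simp
    also have "\<dots> = \<theta> s * \<kappa> * real (Suc s + m) * ?R' s"
      unfolding mix_recurrence[OF m Suc.prems] by simp
    finally have "?A (Suc s) \<le> ?A s + 6 * (real m / \<mu>) * noise * (\<theta> s / real (Suc s))"
      using step[of s] Suc.prems by linarith
    also have "\<dots> \<le> ?B s + 6 * (real m / \<mu>) * noise * (\<theta> s / real (Suc s))"
      using Suc by simp
    also have "\<dots> = ?B (Suc s)" by (simp only: sum.lessThan_Suc distrib_left add.assoc)
    finally show ?case .
  qed
  show "?A s \<le> ?B s" using bound s .
  have "0 \<le> \<theta> s * \<kappa> * real (Suc s + m) * ?R' s"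
    using mix_pos[OF m s] \<kappa> by (intro mult_nonneg_nonneg integral_nonneg_AE) auto
  then have "ref_value z (Suc s) \<le> ?B s + 6 * (real m / \<mu>) * noise * (\<theta> s / real (Suc s))"
    using step[OF s] bound[OF s] by linarith
  also have "\<dots> = ?B (Suc s)" by (simp only: sum.lessThan_Suc distrib_left add.assoc)
  finally show "ref_value z (Suc s) \<le> ?B (Suc s)" .
qed

lemma last_iterate_bound:
  assumes z: "z \<in> edom d \<psi>"
  shows "E (\<lambda>\<omega>. objective (x \<omega> (Suc T)) - objective z)
    \<le> 12 * (\<mu> * (vnorm (z - x1))\<^sup>2 / real ((m + T) choose m)
        + real m * noise * (1 + ln (real T)) / (\<mu> * real T))"
proof -
  obtain s where s: "T = Suc s" using T by (cases T) auto
  have "\<theta> s = 1" using mix_last[OF m, of s] by (simp add: s)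
  moreover have "s + 2 = Suc T" by (simp add: s)
  moreover have "0 \<le> 2 * \<eta> (Suc T) * noise"
    using \<eta>_pos[of "Suc T"] lip_noise(3) by (intro mult_nonneg_nonneg) auto
  ultimately have "E (\<lambda>\<omega>. objective (x \<omega> (Suc T))) \<le> ref_value z (Suc s)"
    unfolding ref_value.simps by simp
  also have "\<dots> \<le> objective z + \<theta> 0 * (\<mu> / (2 * real m)) * (vnorm (z - x1))\<^sup>2
       + 6 * (real m / \<mu>) * noise * (\<Sum>j<T. \<theta> j / real (Suc j))"
    using ref_value_bound(2)[OF z, of s] s by simp
  also have "\<dots> \<le> objective z + \<mu> / real ((m + T) choose m) * (vnorm (z - x1))\<^sup>2
       + 6 * (real m / \<mu>) * noise * (2 * (1 + ln (real T)) / real T)"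
  proof (intro add_mono mult_left_mono mult_right_mono mix_step_sum m T)
    let ?S = "\<Sum>j=0..<T. weight m j"
    have S: "?S > 0" using tail_sum_pos[OF m, of 0 T] T by simp
    have C: "real ((m + T) choose m) > 0" by simp
    have "\<theta> 0 * (\<mu> / (2 * real m)) = \<mu> / (2 * ?S)"
      using m S by (simp add: mix_def weight_def)
    also have "\<dots> \<le> \<mu> / real ((m + T) choose m)"
      using weight_sum_ge[OF m T] C S \<mu>_pos by (intro divide_left_mono) auto
    finally show "\<theta> 0 * (\<mu> / (2 * real m)) \<le> \<mu> / real ((m + T) choose m)" .
    show "0 \<le> 6 * (real m / \<mu>) * noise" using lip_noise(3) \<mu>_pos by simp
  qed auto
  also have "\<dots> \<le> objective z + 12 * (\<mu> * (vnorm (z - x1))\<^sup>2 / real ((m + T) choose m)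
        + real m * noise * (1 + ln (real T)) / (\<mu> * real T))"
  proof -
    have "0 \<le> \<mu> * (vnorm (z - x1))\<^sup>2 / real ((m + T) choose m)" using \<mu>_pos by simp
    moreover have "\<mu> / real ((m + T) choose m) * (vnorm (z - x1))\<^sup>2
        = \<mu> * (vnorm (z - x1))\<^sup>2 / real ((m + T) choose m)" by simp
    moreover have "6 * (real m / \<mu>) * noise * (2 * (1 + ln (real T)) / real T)
        = 12 * (real m * noise * (1 + ln (real T)) / (\<mu> * real T))" by simp
    ultimately show ?thesis unfolding distrib_left[of 12] by linarith
  qed
  finally show ?thesis by simp
qed

end


section \<open>The expectation of extended-real valued outcomes\<close>

lemma ereal_expectation_real:
  fixes Y :: "'a \<Rightarrow> real"
  assumes fin: "finite (set_pmf p)" and X: "\<And>\<omega>. \<omega> \<in> set_pmf p \<Longrightarrow> X \<omega> = ereal (Y \<omega>)"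
  shows "ereal_expectation (measure_pmf p) X = ereal (measure_pmf.expectation p Y)"
proof -
  have int: "integrable (measure_pmf p) h" for h :: "'a \<Rightarrow> real"
    by (rule integrable_measure_pmf_finite[OF fin])
  have part: "enn2ereal (\<integral>\<^sup>+\<omega>. e2ennreal (Z \<omega>) \<partial>measure_pmf p) = ereal (measure_pmf.expectation p (\<lambda>\<omega>. max 0 (h \<omega>)))"
    if "\<And>\<omega>. \<omega> \<in> set_pmf p \<Longrightarrow> Z \<omega> = ereal (h \<omega>)" for Z and h :: "'a \<Rightarrow> real"
  proof -
    have "(\<integral>\<^sup>+\<omega>. e2ennreal (Z \<omega>) \<partial>measure_pmf p) = (\<integral>\<^sup>+\<omega>. ennreal (max 0 (h \<omega>)) \<partial>measure_pmf p)"
    proof (intro nn_integral_cong_AE AE_pmfI)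
      fix \<omega> assume "\<omega> \<in> set_pmf p"
      then show "e2ennreal (Z \<omega>) = ennreal (max 0 (h \<omega>))"
        by (simp add: that max_def ennreal_neg)
    qed
    also have "\<dots> = ennreal (measure_pmf.expectation p (\<lambda>\<omega>. max 0 (h \<omega>)))"
      by (intro nn_integral_eq_integral int) simp
    finally show ?thesis by (simp add: enn2ereal_ennreal integral_nonneg_AE)
  qed
  have "ereal_expectation (measure_pmf p) X
      = ereal (measure_pmf.expectation p (\<lambda>\<omega>. max 0 (Y \<omega>)) - measure_pmf.expectation p (\<lambda>\<omega>. max 0 (- Y \<omega>)))"
    unfolding ereal_expectation_def using part[of X Y] part[of "\<lambda>\<omega>. - X \<omega>" "\<lambda>\<omega>. - Y \<omega>"] X by simp
  also have "\<dots> = ereal (measure_pmf.expectation p (\<lambda>\<omega>. max 0 (Y \<omega>) - max 0 (- Y \<omega>)))"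
    by (simp add: int)
  also have "(\<lambda>\<omega>. max 0 (Y \<omega>) - max 0 (- Y \<omega>)) = Y"
    by (auto simp: max_def)
  finally show ?thesis .
qed

lemma ereal_expectation_minus_infinity:
  assumes X: "\<And>\<omega>. \<omega> \<in> set_pmf p \<Longrightarrow> X \<omega> = -\<infinity>"
  shows "ereal_expectation (measure_pmf p) X = -\<infinity>"
proof -
  have "(\<integral>\<^sup>+\<omega>. e2ennreal (X \<omega>) \<partial>measure_pmf p) = (\<integral>\<^sup>+\<omega>. 0 \<partial>measure_pmf p)"
    by (intro nn_integral_cong_AE AE_pmfI) (simp add: X e2ennreal_neg)
  moreover have "(\<integral>\<^sup>+\<omega>. e2ennreal (- X \<omega>) \<partial>measure_pmf p) = (\<integral>\<^sup>+\<omega>. \<infinity> \<partial>measure_pmf p)"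
    by (intro nn_integral_cong_AE AE_pmfI) (simp add: X)
  ultimately show ?thesis
    by (simp add: ereal_expectation_def zero_ennreal.rep_eq)
qed

theorem theoremA3:
  shows "\<exists>C::real. C > 0 \<and>
    (\<forall>(d::nat) (n::nat) (m::nat) (T::nat) (\<mu>::real)
      (f :: nat \<Rightarrow> real vec \<Rightarrow> real) (g :: nat \<Rightarrow> real vec \<Rightarrow> real vec) (G :: nat \<Rightarrow> real)
      (\<psi> :: real vec \<Rightarrow> ereal) (x1 :: real vec)
      (x :: (nat \<Rightarrow> nat \<Rightarrow> nat) \<Rightarrow> nat \<Rightarrow> real vec) (z :: real vec).
      d \<ge> 1 \<longrightarrow> n \<ge> 1 \<longrightarrow> m \<ge> 1 \<longrightarrow> T \<ge> 1 \<longrightarrow> \<mu> > 0 \<longrightarrow>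
      (\<forall>i\<in>{1..n}. convex_fun d (\<lambda>y. ereal (f i y))) \<longrightarrow>
      (\<forall>i\<in>{1..n}. \<forall>y\<in>carrier_vec d. g i y \<in> subdiff d (\<lambda>w. ereal (f i w)) y) \<longrightarrow>
      (\<forall>i\<in>{1..n}. G i > 0 \<and> lipschitz_with_subgrad (edom d \<psi>) (G i) (f i) (g i)) \<longrightarrow>
      proper_fun d \<psi> \<longrightarrow> closed_fun d \<psi> \<longrightarrow> convex_fun d \<psi> \<longrightarrow> strongly_convex_fun d \<mu> \<psi> \<longrightarrow>
      x1 \<in> edom d \<psi> \<longrightarrow>
      (\<forall>\<omega>\<in>set_pmf (rr_pmf n (epoch n T)).
         prox_gradient_iterates d \<psi> g (\<lambda>t. real m / (\<mu> * real t)) T x1 (rr_index n \<omega>) (x \<omega>)) \<longrightarrow>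
      z \<in> carrier_vec d \<longrightarrow>
      ereal_expectation (measure_pmf (rr_pmf n (epoch n T)))
          (\<lambda>\<omega>. composite n f \<psi> (x \<omega> (T + 1)) - composite n f \<psi> z)
        \<le> ereal (C * (\<mu> * (vnorm (z - x1))\<^sup>2 / real ((m + T) choose m)
               + real m * sqrt (real n) * mean_lip n G * rms_lip n G * (1 + ln (real T))
                   / (\<mu> * real T))))"
proof (intro exI[of _ 12] conjI allI impI)
  fix d n m T :: nat and \<mu> :: real and f :: "nat \<Rightarrow> real vec \<Rightarrow> real"
    and g :: "nat \<Rightarrow> real vec \<Rightarrow> real vec" and G :: "nat \<Rightarrow> real"
    and \<psi> :: "real vec \<Rightarrow> ereal" and x1 :: "real vec"
    and x :: "(nat \<Rightarrow> nat \<Rightarrow> nat) \<Rightarrow> nat \<Rightarrow> real vec" and z :: "real vec"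
  assume hyps: "1 \<le> n" "1 \<le> m" "1 \<le> T" "0 < \<mu>"
    "\<forall>i\<in>{1..n}. convex_fun d (\<lambda>y. ereal (f i y))"
    "\<forall>i\<in>{1..n}. \<forall>y\<in>carrier_vec d. g i y \<in> subdiff d (\<lambda>w. ereal (f i w)) y"
    "\<forall>i\<in>{1..n}. G i > 0 \<and> lipschitz_with_subgrad (edom d \<psi>) (G i) (f i) (g i)"
    "proper_fun d \<psi>" "convex_fun d \<psi>" "strongly_convex_fun d \<mu> \<psi>" "x1 \<in> edom d \<psi>"
    "\<forall>\<omega>\<in>set_pmf (rr_pmf n (epoch n T)).
         prox_gradient_iterates d \<psi> g (\<lambda>t. real m / (\<mu> * real t)) T x1 (rr_index n \<omega>) (x \<omega>)"
    and z: "z \<in> carrier_vec d"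
  interpret random_reshuffling d \<psi> \<mu> n m T f g G x1 x
    by unfold_locales (use hyps in auto)
  have F: "composite n f \<psi> y = ereal (objective y)" if "y \<in> edom d \<psi>" for y
    using \<psi>_eq[OF that] by (simp add: composite_def objective_def fbar_def)
  have x_last: "x \<omega> (T + 1) \<in> edom d \<psi>" if "\<omega> \<in> \<Omega>" for \<omega>
    using x_edom[OF that, of "Suc T"] by simp
  show "ereal_expectation (measure_pmf (rr_pmf n (epoch n T)))
          (\<lambda>\<omega>. composite n f \<psi> (x \<omega> (T + 1)) - composite n f \<psi> z)
        \<le> ereal (12 * (\<mu> * (vnorm (z - x1))\<^sup>2 / real ((m + T) choose m)
               + real m * sqrt (real n) * mean_lip n G * rms_lip n G * (1 + ln (real T))
                   / (\<mu> * real T)))"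
    \<comment> \<open>if \<open>\<psi> z\<close> is infinite, then the expectation is minus infinity\<close>
  proof (cases "z \<in> edom d \<psi>")
    case True
    have "ereal_expectation (measure_pmf (rr_pmf n (epoch n T)))
          (\<lambda>\<omega>. composite n f \<psi> (x \<omega> (T + 1)) - composite n f \<psi> z)
        = ereal (E (\<lambda>\<omega>. objective (x \<omega> (Suc T)) - objective z))"
      using F[OF True] F[OF x_last] by (intro ereal_expectation_real finite_set_rr_pmf) simp
    then show ?thesis
      using last_iterate_bound[OF True] by (simp add: noise_def mult.assoc)
  next
    case False
    then have "\<psi> z = \<infinity>" using z by (simp add: edom_def)
    then have "composite n f \<psi> z = \<infinity>" by (simp add: composite_def)
    then have "ereal_expectation (measure_pmf (rr_pmf n (epoch n T)))
          (\<lambda>\<omega>. composite n f \<psi> (x \<omega> (T + 1)) - composite n f \<psi> z) = -\<infinity>"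
      using F[OF x_last] by (intro ereal_expectation_minus_infinity) simp
    then show ?thesis by simp
  qed
qed simp

end
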